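(* Let $P, Q \in \mathbb{Z}[x_1,\ldots,x_n]$ and suppose that $Q$ is linear in each variable (i.e. every monomial of $Q$ has exponent vector in $\{0,1\}^n$). Then $P/Q$ has the Gauss property if and only if $N(P) \subseteq N(Q)$.
   Context: Write $\boldsymbol{x}=(x_1,\dots,x_n)$ and $\boldsymbol{x}^{\boldsymbol{k}}=x_1^{k_1}\cdots x_n^{k_n}$. For a Laurent polynomial $Q=\sum_{\boldsymbol{k}} q_{\boldsymbol{k}}\boldsymbol{x}^{\boldsymbol{k}}\in\mathbb{Z}[x_1^{\pm1},\dots,x_n^{\pm1}]$, its support is the set of $\boldsymbol{k}$ with $q_{\boldsymbol{k}}\neq 0$, and its Newton polytope $N(Q)$ is the convex hull of its support. For a vertex $\boldsymbol{v}$ of $N(Q)$, one expands $\boldsymbol{x}^{\boldsymbol{v}}/Q = \frac{1}{q_{\boldsymbol{v}}}\sum_{m\ge0}\big(-\sum_{\boldsymbol{k}\neq\boldsymbol{v}}\frac{q_{\boldsymbol{k}}}{q_{\boldsymbol{v}}}\boldsymbol{x}^{\boldsymbol{k}-\boldsymbol{v}}\big)^m$ as a formal Laurent series (well defined, supported in the cone generated by $N(Q/\boldsymbol{x}^{\boldsymbol{v}})$, which is proper); multiplying by $P/\boldsymbol{x}^{\boldsymbol{v}}$ gives the Laurent series expansion of $F=P/Q$ with respect to $\boldsymbol{v}$. A formal Laurent series $f=\sum_{\boldsymbol{k}\in\mathbb{Z}^n} f_{\boldsymbol{k}}\boldsymbol{x}^{\boldsymbol{k}}$ with rational coefficients satisfies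 the Gauss congruences for the prime $p$ if all $f_{\boldsymbol{k}}\in\mathbb{Z}_p$ and $f_{\boldsymbol{m}p^r}\equiv f_{\boldsymbol{m}p^{r-1}} \pmod{p^r}$ for all $\boldsymbol{m}\in\mathbb{Z}^n$, $r\ge1$; it has the Gauss property if it satisfies the Gauss congruences for all but finitely many primes. A rational function $F=P/Q$ ($P,Q\in\mathbb{Z}[\boldsymbol{x}^{\pm1}]$) has the Gauss property if for every vertex $\boldsymbol{v}$ of $N(Q)$ the Laurent series expansion of $F$ with respect to $\boldsymbol{v}$ has the Gauss property. *)

theory Defs
  imports "HOL-Analysis.Analysis" "HOL-Library.Poly_Mapping"
begin

text \<open>
  The variables $x_i$ are indexed by a finite type \<open>'n\<close>. A Laurent polynomial is a finitely
  supported map from exponent vectors to coefficients, with the convolution product of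
  \<open>Poly_Mapping\<close>; its support is \<open>Poly_Mapping.keys\<close>.
\<close>

type_synonym ('n, 'a) laurent_poly = "(int ^ 'n) \<Rightarrow>\<^sub>0 'a"

type_synonym 'n laurent_series = "int ^ 'n \<Rightarrow> rat"

definition is_polynomial :: "('n::finite, int) laurent_poly \<Rightarrow> bool" where
  "is_polynomial Q \<longleftrightarrow> (\<forall>k \<in> Poly_Mapping.keys Q. \<forall>i. 0 \<le> k $ i)"

definition linear_in_each_variable :: "('n::finite, int) laurent_poly \<Rightarrow> bool" where
  "linear_in_each_variable Q \<longleftrightarrow> (\<forall>k \<in> Poly_Mapping.keys Q. \<forall>i. k $ i \<in> {0, 1})"

definition real_exponent :: "int ^ 'n::finite \<Rightarrow> real ^ 'n" where
  "real_exponent k = (\<chi> i. real_of_int (k $ i))"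

definition newton_polytope :: "('n::finite, int) laurent_poly \<Rightarrow> (real ^ 'n) set" where
  "newton_polytope Q = convex hull (real_exponent ` Poly_Mapping.keys Q)"

text \<open>
  Every vertex of the Newton polytope lies in the support, so restricting to integer vectors
  loses no vertex.
\<close>

definition newton_vertex :: "('n::finite, int) laurent_poly \<Rightarrow> int ^ 'n \<Rightarrow> bool" where
  "newton_vertex Q v \<longleftrightarrow> real_exponent v extreme_point_of newton_polytope Q"

text \<open>
  The Laurent polynomial $B = -\sum_{k \neq v} (q_k / q_v)\, x^{k - v}$, for which
  $Q = q_v\, x^v (1 - B)$.
\<close>

definition geometric_base ::
    "('n::finite, int) laurent_poly \<Rightarrow> int ^ 'n \<Rightarrow> ('n, rat) laurent_poly" where
  "geometric_base Q v =
     - (\<Sum>k \<in> Poly_Mapping.keys Q - {v}. Poly_Mapping.single (k - v) (of_int (Poly_Mapping.lookup Q k) / of_int (Poly_Mapping.lookup Q v)))"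

text \<open>
  The expansion of $x^v / Q = q_v^{-1} \sum_{m \ge 0} B^m$. For a vertex \<open>v\<close> only finitely many
  powers of $B$ contribute to a given coefficient, see \<open>finite_contributing_powers\<close> below; when
  \<open>v\<close> is not a vertex the value has no meaning.
\<close>

definition inverse_expansion ::
    "('n::finite, int) laurent_poly \<Rightarrow> int ^ 'n \<Rightarrow> 'n laurent_series" where
  "inverse_expansion Q v u =
     (\<Sum>m \<in> {m. Poly_Mapping.lookup (geometric_base Q v ^ m) u \<noteq> 0}. Poly_Mapping.lookup (geometric_base Q v ^ m) u)
       / of_int (Poly_Mapping.lookup Q v)"

text \<open>The product of $P / x^v$ with the expansion of $x^v / Q$.\<close>

definition laurent_expansion ::
    "('n::finite, int) laurent_poly \<Rightarrow> ('n, int) laurent_poly \<Rightarrow> int ^ 'n \<Rightarrow> 'n laurent_series" where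
  "laurent_expansion P Q v u =
     (\<Sum>k \<in> Poly_Mapping.keys P. of_int (Poly_Mapping.lookup P k) * inverse_expansion Q v (u - (k - v)))"

text \<open>
  For a prime \<open>p\<close>, the rational numbers lying in $\mathbb{Z}_p$: those with a denominator not
  divisible by \<open>p\<close> (note that \<open>b \<noteq> 0\<close> is implied). Congruence modulo $p^r$ is taken in
  $\mathbb{Z}_p$.
\<close>

definition p_integral :: "nat \<Rightarrow> rat \<Rightarrow> bool" where
  "p_integral p x \<longleftrightarrow> (\<exists>a b :: int. \<not> int p dvd b \<and> x = of_int a / of_int b)"

definition cong_prime_power :: "nat \<Rightarrow> nat \<Rightarrow> rat \<Rightarrow> rat \<Rightarrow> bool" where
  "cong_prime_power p r x y \<longleftrightarrow> (\<exists>z. p_integral p z \<and> x - y = of_nat (p ^ r) * z)"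

definition gauss_congruences :: "nat \<Rightarrow> 'n::finite laurent_series \<Rightarrow> bool" where
  "gauss_congruences p f \<longleftrightarrow>
     (\<forall>k. p_integral p (f k)) \<and>
     (\<forall>m. \<forall>r \<ge> 1. cong_prime_power p r (f (int (p ^ r) *s m)) (f (int (p ^ (r - 1)) *s m)))"

definition series_gauss_property :: "'n::finite laurent_series \<Rightarrow> bool" where
  "series_gauss_property f \<longleftrightarrow> finite {p. prime p \<and> \<not> gauss_congruences p f}"

text \<open>The Gauss property of the rational function $P / Q$.\<close>

definition gauss_property ::
    "('n::finite, int) laurent_poly \<Rightarrow> ('n, int) laurent_poly \<Rightarrow> bool" where
  "gauss_property P Q \<longleftrightarrow>
     (\<forall>v. newton_vertex Q v \<longrightarrow> series_gauss_property (laurent_expansion P Q v))"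

lemma finite_contributing_powers:
  fixes Q :: "('n::finite, int) laurent_poly"
  assumes "newton_vertex Q v"
  shows "finite {m. Poly_Mapping.lookup (geometric_base Q v ^ m) u \<noteq> 0}"
proof -
  let ?B = "geometric_base Q v"
  let ?S = "real_exponent ` Poly_Mapping.keys Q"
  have inj: "k = k'" if "real_exponent k = real_exponent k'" for k k' :: "int ^ 'n"
    using that by (simp add: real_exponent_def vec_eq_iff)
  have diff: "real_exponent (k - k') = real_exponent k - real_exponent k'" for k k' :: "int ^ 'n"
    by (simp add: real_exponent_def vec_eq_iff)
  have add: "real_exponent (k + k') = real_exponent k + real_exponent k'" for k k' :: "int ^ 'n"
    by (simp add: real_exponent_def vec_eq_iff)
  have ext: "real_exponent v extreme_point_of convex hull ?S"
    using assms by (simp add: newton_vertex_def newton_polytope_def)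
  have notin: "real_exponent v \<notin> convex hull (?S - {real_exponent v})"
  proof
    assume "real_exponent v \<in> convex hull (?S - {real_exponent v})"
    then have "convex hull ?S = convex hull (?S - {real_exponent v})"
      by (metis hull_insert hull_redundant insert_Diff_single insert_absorb
          ext extreme_point_of_convex_hull)
    then show False
      using ext extreme_point_of_convex_hull by fastforce
  qed
  have "closed (convex hull (?S - {real_exponent v}))"
    by (simp add: compact_imp_closed finite_imp_compact_convex_hull)
  then obtain a b where ab: "a \<bullet> real_exponent v < b"
      "\<And>x. x \<in> convex hull (?S - {real_exponent v}) \<Longrightarrow> b < a \<bullet> x"
    using separating_hyperplane_closed_point[OF convex_convex_hull _ notin] by blast
  define d where "d = b - a \<bullet> real_exponent v"
  have "d > 0" using ab(1) by (simp add: d_def)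
  have base: "d \<le> a \<bullet> real_exponent k" if "k \<in> Poly_Mapping.keys ?B" for k
  proof -
    have "Poly_Mapping.keys (\<Sum>k \<in> Poly_Mapping.keys Q - {v}. Poly_Mapping.single (k - v)
            (of_int (Poly_Mapping.lookup Q k) / of_int (Poly_Mapping.lookup Q v) :: rat))
          \<subseteq> (\<Union>k \<in> Poly_Mapping.keys Q - {v}. {k - v})"
      by (rule order_trans[OF keys_sum]) (auto split: if_splits)
    with that obtain l where l: "l \<in> Poly_Mapping.keys Q" "l \<noteq> v" "k = l - v"
      by (auto simp: geometric_base_def)
    then have "real_exponent l \<in> ?S - {real_exponent v}"
      using inj by blast
    then have "b < a \<bullet> real_exponent l"
      by (intro ab(2) hull_inc)
    then show ?thesis
      by (simp add: l d_def diff inner_diff_right)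
  qed
  have power: "real m * d \<le> a \<bullet> real_exponent k" if "k \<in> Poly_Mapping.keys (?B ^ m)" for m k
    using that
  proof (induction m arbitrary: k)
    case 0
    then have "k = 0" by (simp add: in_keys_iff lookup_one when_def split: if_splits)
    then show ?case by (simp add: real_exponent_def zero_vec_def[symmetric])
  next
    case (Suc m)
    then obtain k1 k2 where "k1 \<in> Poly_Mapping.keys ?B" "k2 \<in> Poly_Mapping.keys (?B ^ m)" "k = k1 + k2"
      using keys_mult[of ?B "?B ^ m"] by auto
    with base[of k1] Suc.IH[of k2] show ?case
      by (simp add: add inner_add_right algebra_simps)
  qed
  have "{m. Poly_Mapping.lookup (?B ^ m) u \<noteq> 0} \<subseteq> {.. nat \<lceil>a \<bullet> real_exponent u / d\<rceil>}"
  proof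
    fix m assume "m \<in> {m. Poly_Mapping.lookup (?B ^ m) u \<noteq> 0}"
    then have "real m * d \<le> a \<bullet> real_exponent u"
      using power by (simp add: in_keys_iff)
    then have "real m \<le> a \<bullet> real_exponent u / d"
      using \<open>d > 0\<close> by (simp add: field_simps)
    then show "m \<in> {.. nat \<lceil>a \<bullet> real_exponent u / d\<rceil>}"
      by simp linarith
  qed
  then show ?thesis
    using finite_subset by blast
qed

end

theory Submission
  imports Defs "HOL-Number_Theory.Residues"
begin

text \<open>
  Every exponent of $Q$ is a vertex of the unit cube, so every support point of $Q$ is a vertex of
  $N(Q)$, and $N(P) \subseteq N(Q)$ means that the support of $P$ is contained in that of $Q$.

  For sufficiency it is then enough to treat $x^k/Q$ with $k$ in the support of $Q$. Its coefficient
  at $u$ is, up to a constant factor, the sum of $M(a - e_k) \prod_j c_j^{a_j}$ over all families of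
  natural numbers $a$ with $\sum_j a_j (j - v) = u$, where $j$ runs through the support points other
  than $v$, $M$ is the multinomial coefficient, $e_k$ is the unit vector ($e_v = 0$) and
  $c_j = -q_j/q_v$. If $p^r$ divides $u$ and $p^{s+1}$ does not divide $a$, then $p^{r-s}$ divides
  $M(a - e_k)$: a residue pattern without carries modulo $p^t$, $s < t \le r$, is excluded because
  the exponents are 0 or 1. On the other hand, replacing $a$ by $pa$ changes $M(a - e_k)$
  only by a factor congruent to 1 modulo $p^s$ if $p^{s-1}$ divides $a$. So the terms with $a$ not
  divisible by $p$ vanish modulo $p^r$, and the other ones match the terms at $u/p$.

  For necessity, a point of $N(P)$ outside $N(Q)$ is separated by a linear functional that has a unique
  minimum $v$ on the support of $Q$. Minimizing the functional on the support of $P$ at $l$, the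
  expansion at $v$ has a nonzero coefficient at $l - v$ but vanishes at $p (l - v)$ for all primes $p$.
\<close>

section \<open>Multinomial coefficients and Legendre's formula\<close>

definition multinomial_coeff :: "'a set \<Rightarrow> ('a \<Rightarrow> nat) \<Rightarrow> nat" where
  "multinomial_coeff J a = fact (sum a J) div (\<Prod>j\<in>J. fact (a j))"

text \<open>Fixing the value 0 outside \<open>J\<close> lets every family on \<open>J\<close> occur
  exactly once in sums over this set.\<close>

definition compositions :: "'a set \<Rightarrow> nat \<Rightarrow> ('a \<Rightarrow> nat) set" where
  "compositions J m = {a. (\<forall>j. j \<notin> J \<longrightarrow> a j = 0) \<and> sum a J = m}"

lemma prod_fact_dvd_fact_sum:
  "finite J \<Longrightarrow> (\<Prod>j\<in>J. fact (a j) :: nat) dvd fact (sum a J)"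
proof (induction J rule: finite_induct)
  case (insert k J)
  have "(\<Prod>j\<in>insert k J. fact (a j) :: nat) dvd fact (a k) * fact (sum a J)"
    using insert by (simp add: mult_dvd_mono)
  also have "\<dots> dvd fact (a k + sum a J)"
    by (rule fact_fact_dvd_fact)
  finally show ?case using insert by simp
qed simp

lemma multinomial_coeff_mult_prod_fact:
  "finite J \<Longrightarrow> multinomial_coeff J a * (\<Prod>j\<in>J. fact (a j)) = fact (sum a J)"
  unfolding multinomial_coeff_def by (rule dvd_div_mult_self) (rule prod_fact_dvd_fact_sum)

lemma multinomial_coeff_insert:
  assumes "finite J" "k \<notin> J"
  shows "multinomial_coeff (insert k J) a = ((a k + sum a J) choose a k) * multinomial_coeff J a"
proof -
  have "multinomial_coeff (insert k J) a * (fact (a k) * (\<Prod>j\<in>J. fact (a j)))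
      = fact (a k + sum a J)"
    using multinomial_coeff_mult_prod_fact[of "insert k J" a] assms by simp
  also have "\<dots> = fact (a k) * fact (sum a J) * ((a k + sum a J) choose a k)"
    using binomial_fact_lemma[of "a k" "a k + sum a J"] by simp
  also have "\<dots> = ((a k + sum a J) choose a k) * multinomial_coeff J a *
      (fact (a k) * (\<Prod>j\<in>J. fact (a j)))"
    using multinomial_coeff_mult_prod_fact[OF assms(1), of a] by (simp add: ac_simps)
  finally show ?thesis
    using assms by simp
qed

lemma multinomial_coeff_cong:
  "(\<And>j. j \<in> J \<Longrightarrow> a j = b j) \<Longrightarrow> multinomial_coeff J a = multinomial_coeff J b"
  by (simp add: multinomial_coeff_def)

lemma finite_compositions:
  assumes "finite J"
  shows "finite (compositions J m)"
proof (rule finite_subset)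
  show "compositions J m \<subseteq> {a. \<forall>j. (j \<in> J \<longrightarrow> a j \<in> {..m}) \<and> (j \<notin> J \<longrightarrow> a j = 0)}"
    using assms by (auto simp: compositions_def intro: member_le_sum)
  show "finite \<dots>"
    using assms by (intro finite_set_of_finite_funs) auto
qed

text \<open>Induction on \<open>J\<close>: the binomial theorem supplies the exponent
  \<open>i\<close> of \<open>x k\<close>, the induction hypothesis those on \<open>J\<close>, and
  \<open>a(k := i)\<close> joins them.\<close>

lemma multinomial_theorem:
  fixes x :: "'a \<Rightarrow> 'b::comm_semiring_1"
  assumes "finite J"
  shows "sum x J ^ m
    = (\<Sum>a\<in>compositions J m. of_nat (multinomial_coeff J a) * (\<Prod>j\<in>J. x j ^ a j))"
  using assms
proof (induction J arbitrary: m rule: finite_induct)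
  case empty
  have "compositions {} m = (if m = 0 then {\<lambda>_::'a. 0} else {})"
    by (auto simp: compositions_def)
  then show ?case
    by (simp add: multinomial_coeff_def power_0_left)
next
  case (insert k J)
  let ?t = "\<lambda>J a. of_nat (multinomial_coeff J a) * (\<Prod>j\<in>J. x j ^ a j) :: 'b"
  have eq: "?t (insert k J) (a(k := i)) = of_nat (m choose i) * x k ^ i * ?t J a"
    if "a \<in> compositions J (m - i)" "i \<le> m" for i a
  proof -
    have "sum (a(k := i)) J = sum a J" "(\<Prod>j\<in>J. x j ^ (a(k := i)) j) = (\<Prod>j\<in>J. x j ^ a j)"
      using insert.hyps by (auto intro!: sum.cong prod.cong)
    moreover have "multinomial_coeff J (a(k := i)) = multinomial_coeff J a"
      using insert.hyps by (intro multinomial_coeff_cong) auto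
    ultimately show ?thesis
      using insert.hyps that by (simp add: multinomial_coeff_insert compositions_def algebra_simps)
  qed
  have "sum x (insert k J) ^ m = (\<Sum>i\<le>m. of_nat (m choose i) * x k ^ i * sum x J ^ (m - i))"
    using insert.hyps by (simp add: binomial_ring)
  also have "\<dots> = (\<Sum>i\<le>m. \<Sum>a\<in>compositions J (m - i). of_nat (m choose i) * x k ^ i * ?t J a)"
    by (simp add: insert.IH sum_distrib_left)
  also have "\<dots> = (\<Sum>i\<le>m. \<Sum>a\<in>compositions J (m - i). ?t (insert k J) (a(k := i)))"
    by (intro sum.cong refl) (simp only: eq atMost_iff)
  also have "\<dots> = (\<Sum>(i, a)\<in>(SIGMA i:{..m}. compositions J (m - i)). ?t (insert k J) (a(k := i)))"
    using insert.hyps by (intro sum.Sigma) (auto intro: finite_compositions)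
  also have "\<dots> = (\<Sum>a\<in>compositions (insert k J) m. ?t (insert k J) a)"
  proof (rule sum.reindex_bij_witness[where i = "\<lambda>a. (a k, a(k := 0))" and j = "\<lambda>(i, a). a(k := i)"])
    fix b assume "b \<in> (SIGMA i:{..m}. compositions J (m - i))"
    then obtain i a where b: "b = (i, a)" "i \<le> m" "a \<in> compositions J (m - i)" by auto
    have "sum (a(k := i)) J = sum a J"
      using insert.hyps by (intro sum.cong) auto
    with b insert.hyps show "(case b of (i, a) \<Rightarrow> a(k := i)) \<in> compositions (insert k J) m"
      by (auto simp: compositions_def)
    show "((case b of (i, a) \<Rightarrow> a(k := i)) k, (case b of (i, a) \<Rightarrow> a(k := i))(k := 0)) = b"
      using b insert.hyps by (auto simp: compositions_def)
  next
    fix a assume a: "a \<in> compositions (insert k J) m"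
    have "sum (a(k := 0)) J = sum a J"
      using insert.hyps by (intro sum.cong) auto
    with a insert.hyps show "(a k, a(k := 0)) \<in> (SIGMA i:{..m}. compositions J (m - i))"
      by (auto simp: compositions_def)
  qed auto
  finally show ?case .
qed

section \<open>Legendre's formula and carries\<close>

lemma multiplicity_eq_card_dvd_powers:
  assumes "prime p" "0 < n" "n \<le> R"
  shows "multiplicity p n = card {t \<in> {1..R}. p ^ t dvd (n::nat)}"
proof -
  have p: "\<not> is_unit p" "n \<noteq> 0" using assms by auto
  have le: "t \<le> R" if "p ^ t dvd n" for t
  proof -
    have "t < 2 ^ t" by (rule less_exp)
    also have "\<dots> \<le> p ^ t" using assms prime_ge_2_nat by (intro power_mono) auto
    also have "\<dots> \<le> n" using that assms by (intro dvd_imp_le) auto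
    finally show ?thesis using assms by simp
  qed
  have "{t \<in> {1..R}. p ^ t dvd n} = {1..multiplicity p n}"
    using le p by (auto simp: power_dvd_iff_le_multiplicity)
  then show ?thesis by simp
qed

text \<open>Passing from \<open>n\<close> to \<open>Suc n\<close> raises the quotient by
  \<open>p ^ t\<close> by one exactly when \<open>p ^ t\<close> divides \<open>Suc n\<close>. The
  free bound \<open>R\<close> lets several factorials share one range of summation.\<close>

lemma Legendre_formula:
  assumes "prime p" "n \<le> R"
  shows "multiplicity p (fact n) = (\<Sum>t\<in>{1..R}. n div (p::nat) ^ t)"
  using assms(2)
proof (induction n)
  case (Suc n)
  have "multiplicity p (fact (Suc n)) = multiplicity p (Suc n) + multiplicity p (fact n)"
    using assms(1) by (simp add: prime_elem_multiplicity_mult_distrib del: mult_Suc)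
  also have "multiplicity p (Suc n) = (\<Sum>t\<in>{1..R}. of_bool (p ^ t dvd Suc n))"
    using multiplicity_eq_card_dvd_powers[OF assms(1), of "Suc n" R] Suc.prems by (simp add: Int_def)
  also have "\<dots> + multiplicity p (fact n) = (\<Sum>t\<in>{1..R}. of_bool (p ^ t dvd Suc n) + n div p ^ t)"
    using Suc by (simp add: sum.distrib)
  also have "\<dots> = (\<Sum>t\<in>{1..R}. Suc n div p ^ t)"
    by (intro sum.cong) (auto simp: div_Suc dvd_eq_mod_eq_0)
  finally show ?case .
qed simp

lemma sum_div_le_div_sum:
  fixes f :: "'a \<Rightarrow> nat"
  assumes "finite J"
  shows "(\<Sum>j\<in>J. f j div q) \<le> sum f J div q"
  using assms
proof (induction J rule: finite_induct)
  case (insert k J)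
  then show ?case
    using div_add1_eq[of "f k" "sum f J" q] by simp
qed simp

text \<open>By Legendre's formula the valuation of the coefficient at \<open>p\<close> is the sum
  over \<open>t\<close> of \<open>sum f J div p ^ t\<close> minus the sum of the
  \<open>f j div p ^ t\<close>. No such difference is negative, and those with
  \<open>s < t \<le> r\<close> are at least 1.\<close>

lemma prime_power_dvd_multinomial_coeff:
  fixes f :: "'a \<Rightarrow> nat"
  assumes "prime p" "finite J"
    and "\<And>t. s < t \<Longrightarrow> t \<le> r \<Longrightarrow> (\<Sum>j\<in>J. f j div p ^ t) < sum f J div p ^ t"
  shows "p ^ (r - s) dvd multinomial_coeff J f"
proof -
  \<comment> \<open>Large enough for Legendre's formula to apply to all the factorials and for the
    range to contain \<open>{s<..r}\<close>.\<close>
  define R where "R = max r (sum f J)"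
  have nz: "multinomial_coeff J f \<noteq> 0"
    using multinomial_coeff_mult_prod_fact[OF assms(2), of f] by (metis fact_nonzero mult_zero_left)
  have le: "f j \<le> R" if "j \<in> J" for j
    using member_le_sum[OF that, of f] assms(2) by (simp add: R_def)
  have "multiplicity p (multinomial_coeff J f) + (\<Sum>j\<in>J. multiplicity p (fact (f j)))
      = multiplicity p (fact (sum f J))"
    using assms nz
    by (simp flip: multinomial_coeff_mult_prod_fact
        add: prime_elem_multiplicity_mult_distrib prime_elem_multiplicity_prod_distrib image_iff)
  moreover have "(\<Sum>j\<in>J. multiplicity p (fact (f j))) = (\<Sum>t\<in>{1..R}. \<Sum>j\<in>J. f j div p ^ t)"
    using le by (simp add: Legendre_formula[OF assms(1), of _ R] sum.swap[of _ _ J])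
  moreover have "multiplicity p (fact (sum f J)) = (\<Sum>t\<in>{1..R}. sum f J div p ^ t)"
    by (rule Legendre_formula[OF assms(1)]) (simp add: R_def)
  moreover have "(\<Sum>t\<in>{1..R}. (\<Sum>j\<in>J. f j div p ^ t) + of_bool (t \<in> {s<..r})) \<le> (\<Sum>t\<in>{1..R}. sum f J div p ^ t)"
    using assms(3) sum_div_le_div_sum[OF assms(2), of f]
    by (intro sum_mono) (auto simp: Suc_le_eq)
  moreover have "(\<Sum>t\<in>{1..R}. of_bool (t \<in> {s<..r}) :: nat) = r - s"
  proof -
    have "{1..R} \<inter> {s<..r} = {s<..r}" by (auto simp: R_def)
    then show ?thesis by (simp add: Int_def)
  qed
  ultimately have "r - s \<le> multiplicity p (multinomial_coeff J f)"
    by (simp add: sum.distrib)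
  then show ?thesis
    by (rule multiplicity_dvd')
qed

section \<open>Divisibility and congruences of reduced multinomial coefficients\<close>

text \<open>
  The coefficient \<open>multinomial_coeff J (a - e\<^sub>k)\<close>. The case \<open>a k = 0\<close> is separated because of
  truncated subtraction; for \<open>k \<notin> J\<close> the value is \<open>multinomial_coeff J a\<close>.
\<close>

definition reduced_multinomial :: "'a set \<Rightarrow> 'a \<Rightarrow> ('a \<Rightarrow> nat) \<Rightarrow> nat" where
  "reduced_multinomial J k a =
    (if k \<in> J \<and> a k = 0 then 0 else multinomial_coeff J (a(k := a k - 1)))"

text \<open>If another entry \<open>y l\<close> were positive, a coordinate \<open>i\<close> in
  exactly one of \<open>E k\<close> and \<open>E l\<close> would give an incidence sum that is
  positive but omits a positive entry, so it would lie strictly between 0 and \<open>q\<close>.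
  Hence all the weight \<open>q\<close> sits at \<open>k\<close>.\<close>

lemma dvd_all_if_dvd_incidence_sums:
  fixes y :: "'a \<Rightarrow> nat" and E :: "'a \<Rightarrow> 'i set"
  assumes "finite K" "k \<in> K" "inj_on E K" "0 < y k" "sum y K = q"
    and dvd: "\<And>i. q dvd (\<Sum>j\<in>{j\<in>K. i \<in> E j}. y j)"
    and "j \<in> K"
  shows "q dvd y j"
proof -
  have zero: "y l = 0" if l: "l \<in> K" "l \<noteq> k" for l
  proof (rule ccontr)
    assume "y l \<noteq> 0"
    have "E l \<noteq> E k" using assms l by (auto dest: inj_onD)
    then obtain i m n where mn: "{m, n} = {k, l}" "i \<in> E m" "i \<notin> E n" by blast
    have pos: "0 < y m" "0 < y n" "m \<in> K" "n \<in> K"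
      using mn(1) \<open>y l \<noteq> 0\<close> assms l by (auto simp: doubleton_eq_iff)
    let ?S = "{j\<in>K. i \<in> E j}"
    have "0 < sum y ?S"
      using pos mn assms(1) by (intro sum_pos2[of _ m]) auto
    moreover have "sum y ?S + y n \<le> q"
    proof -
      have "sum y ?S + y n = sum y (insert n ?S)"
        using mn assms(1) by simp
      also have "\<dots> \<le> sum y K"
        using pos assms(1) by (intro sum_mono2) auto
      finally show ?thesis using assms by simp
    qed
    ultimately show False
      using dvd[of i] pos by (auto dest: dvd_imp_le)
  qed
  have "q = y k"
    using assms(1,2,5) zero sum.remove[of K k y] by simp
  then show ?thesis
    using zero[OF \<open>j \<in> K\<close>] by (cases "j = k") auto
qed

text \<open>
  By Legendre's formula each \<open>t\<close> in \<open>{s<..r}\<close> at which adding up the entries of \<open>a - e\<^sub>k\<close> produces a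
  carry contributes a factor \<open>p\<close>. If there were no carry at \<open>t\<close>, the residues modulo \<open>p ^ t\<close>,
  with \<open>e\<^sub>k\<close> added back and filled up at \<open>v\<close> to have total \<open>p ^ t\<close>, would violate the previous lemma.
\<close>

lemma prime_power_dvd_reduced_multinomial:
  fixes E :: "'a \<Rightarrow> 'i set"
  assumes "prime p" "finite J" "v \<notin> J" "inj_on E (insert v J)" "E v = {}" "k \<in> insert v J"
    and dvd: "\<And>i. p ^ r dvd (\<Sum>j\<in>{j\<in>J. i \<in> E j}. a j)"
    and "l \<in> J" and ndvd: "\<not> p ^ Suc s dvd a l"
  shows "p ^ (r - s) dvd reduced_multinomial J k a"
proof (cases "k \<in> J \<and> a k = 0")
  case False
  define b where "b = a(k := a k - 1)"
  \<comment> \<open>Here the truncated subtraction is exact, so restoring the unit at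
    \<open>k\<close> recovers \<open>a\<close> on \<open>J\<close>.\<close>
  have a: "a j = b j + of_bool (j = k)" if "j \<in> J" for j
    using False that by (auto simp: b_def)
  have "p ^ (r - s) dvd multinomial_coeff J b"
  proof (rule prime_power_dvd_multinomial_coeff[OF assms(1,2)])
    fix t assume t: "s < t" "t \<le> r"
    define q where "q = p ^ t"
    have "0 < q" using assms(1) by (simp add: q_def prime_gt_0_nat)
    show "(\<Sum>j\<in>J. b j div p ^ t) < sum b J div p ^ t"
    proof (rule ccontr)
      assume "\<not> ?thesis"
      then have eq: "(\<Sum>j\<in>J. b j div q) = sum b J div q"
        using sum_div_le_div_sum[OF assms(2), of b q] by (simp add: q_def)
      have "sum b J = (\<Sum>j\<in>J. q * (b j div q) + b j mod q)"
        by simp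
      also have "\<dots> = q * (sum b J div q) + (\<Sum>j\<in>J. b j mod q)"
        by (simp only: sum.distrib sum_distrib_left[symmetric] eq)
      \<comment> \<open>Without a carry the quotients cancel, and the residues add up to the residue
        of the total.\<close>
      finally have "(\<Sum>j\<in>J. b j mod q) = sum b J mod q"
        using mult_div_mod_eq[of q "sum b J"] by linarith
      then have less: "(\<Sum>j\<in>J. b j mod q) < q"
        using \<open>0 < q\<close> by simp
      \<comment> \<open>By \<open>less\<close> the subtraction in the entry at \<open>v\<close> is
        exact; the unit added at \<open>k\<close> brings the total to \<open>q\<close>, also when
        \<open>k = v\<close>.\<close>
      define y where
        "y j = (if j = v then q - 1 - (\<Sum>j\<in>J. b j mod q) else b j mod q) + of_bool (j = k)" for j
      have y: "y j = b j mod q + of_bool (j = k)" if "j \<in> J" for j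
        using that assms(3) by (auto simp: y_def)
      have sum1: "(\<Sum>j\<in>insert v J. of_bool (j = k)) = (1::nat)"
        using assms(2,6) by (subst sum.remove[of _ k]) auto
      have "sum y (insert v J)
          = (q - 1 - (\<Sum>j\<in>J. b j mod q)) + (\<Sum>j\<in>J. b j mod q)
            + (\<Sum>j\<in>insert v J. of_bool (j = k))"
        using assms(2,3) y by (simp add: sum.distrib y_def[of v] algebra_simps del: sum_of_bool_eq)
      then have sum_y: "sum y (insert v J) = q"
        using less sum1 by simp
      have "q dvd y l"
      proof (rule dvd_all_if_dvd_incidence_sums[OF _ assms(6,4) _ sum_y])
        fix i
        let ?S = "{j\<in>J. i \<in> E j}"
        have S: "{j \<in> insert v J. i \<in> E j} = ?S"
          using assms(5) by auto
        have "[sum y ?S = (\<Sum>j\<in>?S. a j)] (mod q)"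
          using y a by (intro cong_sum) (auto simp: cong_def mod_simps)
        moreover have "q dvd (\<Sum>j\<in>?S. a j)"
          using dvd[of i] t by (auto simp: q_def intro: power_le_dvd)
        ultimately show "q dvd (\<Sum>j\<in>{j \<in> insert v J. i \<in> E j}. y j)"
          unfolding S using cong_dvd_iff by blast
      qed (use assms in \<open>auto simp: y_def\<close>)
      moreover have "[y l = a l] (mod q)"
        using y a \<open>l \<in> J\<close> by (simp add: cong_def mod_simps)
      ultimately have "p ^ t dvd a l"
        using cong_dvd_iff q_def by blast
      then show False
        using ndvd t by (meson Suc_leI power_le_dvd)
    qed
  qed
  then show ?thesis
    using False by (auto simp: reduced_multinomial_def b_def)
qed (auto simp: reduced_multinomial_def)

section \<open>Factorials and multinomial coefficients under multiplication by a prime\<close>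

text \<open>Multiples of \<open>p\<close> are left out entirely, not merely stripped of their
  factors \<open>p\<close>. For prime \<open>p\<close> this is, up to sign, the value of Morita's
  p-adic Gamma function at \<open>n + 1\<close>.\<close>

definition fact_coprime_part :: "nat \<Rightarrow> nat \<Rightarrow> nat" where
  "fact_coprime_part p n = \<Prod>{i\<in>{1..n}. \<not> p dvd i}"

lemma coprime_fact_coprime_part:
  "prime p \<Longrightarrow> coprime (fact_coprime_part p n) p"
  unfolding fact_coprime_part_def
  by (intro prod_coprime_left) (auto intro: coprime_commute[THEN iffD1] prime_imp_coprime)

text \<open>The \<open>n\<close> multiples of \<open>p\<close> up to \<open>p * n\<close> contribute
  \<open>p ^ n * fact n\<close>.\<close>

lemma fact_prime_mult:
  assumes "0 < p"
  shows "fact (p * n) = p ^ n * fact n * fact_coprime_part p (p * n)"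
proof -
  have "{1..p * n} = {i\<in>{1..p * n}. p dvd i} \<union> {i\<in>{1..p * n}. \<not> p dvd i}"
    by auto
  then have "(fact (p * n) :: nat) = \<Prod>{i\<in>{1..p * n}. p dvd i} * fact_coprime_part p (p * n)"
    unfolding fact_prod fact_coprime_part_def
    by (subst prod.union_disjoint[symmetric]) (auto intro!: prod.cong)
  also have "{i\<in>{1..p * n}. p dvd i} = (*) p ` {1..n}"
    using assms by (auto elim!: dvdE)
  also have "\<Prod>((*) p ` {1..n}) = p ^ n * fact n"
    using assms by (subst prod.reindex) (auto simp: inj_on_def prod.distrib fact_prod)
  finally show ?thesis .
qed

text \<open>The range \<open>{1..q * h}\<close> falls into \<open>h\<close> blocks of length
  \<open>q\<close>, each congruent modulo \<open>q\<close> to the first. As \<open>p\<close> divides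
  \<open>q\<close>, the shifts respect divisibility by \<open>p\<close>.\<close>

lemma fact_coprime_part_cong_power:
  assumes "p dvd q"
  shows "[fact_coprime_part p (q * h) = fact_coprime_part p q ^ h] (mod q)"
proof (induction h)
  case (Suc h)
  have "{i\<in>{1..q * Suc h}. \<not> p dvd i} =
      {i\<in>{1..q * h}. \<not> p dvd i} \<union> (+) (q * h) ` {i\<in>{1..q}. \<not> p dvd i}" (is "?A = ?B \<union> ?C")
  proof -
    have dvd: "p dvd q * h" using assms by simp
    have "i \<in> ?C" if "i \<in> ?A - ?B" for i
    proof (rule image_eqI)
      show i: "i = q * h + (i - q * h)" using that by auto
      have "\<not> p dvd i - q * h"
        using that dvd i by (metis (no_types, lifting) DiffD1 dvd_add mem_Collect_eq)
      then show "i - q * h \<in> {i\<in>{1..q}. \<not> p dvd i}"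
        using that by auto
    qed
    moreover have "?B \<subseteq> ?A" by auto
    moreover have "?C \<subseteq> ?A"
      using dvd by (auto simp: dvd_add_right_iff)
    ultimately show ?thesis by blast
  qed
  moreover have "?B \<inter> ?C = {}" "finite ?B" "finite ?C"
    by auto
  ultimately have "fact_coprime_part p (q * Suc h) = fact_coprime_part p (q * h) * \<Prod>?C"
    unfolding fact_coprime_part_def by (simp only: prod.union_disjoint)
  also have "\<Prod>?C = (\<Prod>i\<in>{i\<in>{1..q}. \<not> p dvd i}. q * h + i)"
    by (subst prod.reindex) auto
  also have "[fact_coprime_part p (q * h) * \<dots>
      = fact_coprime_part p q ^ h * fact_coprime_part p q] (mod q)"
    unfolding fact_coprime_part_def[of p q]
    by (intro cong_mult cong_prod Suc.IH[unfolded fact_coprime_part_def[of p q]]) (auto simp: cong_def)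
  finally show ?case by (simp add: mult.commute)
qed (simp add: fact_coprime_part_def)

text \<open>The powers of \<open>p\<close> split off from the factorials cancel, since their
  exponents \<open>b j\<close> add up to \<open>sum b J\<close>. Cross-multiplication keeps the
  identity in the natural numbers.\<close>

lemma multinomial_coeff_prime_mult:
  assumes "0 < p" "finite J"
  shows "multinomial_coeff J (\<lambda>j. p * b j) * (\<Prod>j\<in>J. fact_coprime_part p (p * b j))
    = multinomial_coeff J b * fact_coprime_part p (p * sum b J)"
proof -
  let ?U = "\<Prod>j\<in>J. fact_coprime_part p (p * b j)"
  let ?c = "p ^ sum b J * (\<Prod>j\<in>J. fact (b j))"
  have "(\<Prod>j\<in>J. fact (p * b j)) = ?c * ?U"
    using assms by (simp add: fact_prime_mult prod.distrib power_sum)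
  then have "multinomial_coeff J (\<lambda>j. p * b j) * ?U * ?c = fact (p * sum b J)"
    using multinomial_coeff_mult_prod_fact[OF assms(2), of "\<lambda>j. p * b j"]
    by (simp add: sum_distrib_left ac_simps)
  also have "\<dots> = multinomial_coeff J b * fact_coprime_part p (p * sum b J) * ?c"
    using assms by (simp add: fact_prime_mult multinomial_coeff_mult_prod_fact[symmetric, of J b] ac_simps)
  finally show ?thesis
    using assms by simp
qed

text \<open>If \<open>a k\<close> is positive, removing one unit at \<open>k\<close> divides the
  factorial of the total by \<open>sum a J\<close> and the product of factorials by
  \<open>a k\<close>. This carries results over from ordinary to reduced coefficients.\<close>

lemma reduced_multinomial_mult_sum:
  assumes "finite J" "k \<in> J"
  shows "reduced_multinomial J k a * sum a J = multinomial_coeff J a * a k"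
proof (cases "a k = 0")
  case True
  then show ?thesis using assms by (simp add: reduced_multinomial_def)
next
  case False
  let ?b = "a(k := a k - 1)"
  have rest: "sum ?b (J - {k}) = sum a (J - {k})"
    "(\<Prod>j\<in>J - {k}. fact (?b j)) = ((\<Prod>j\<in>J - {k}. fact (a j)) :: nat)"
    by (auto intro!: sum.cong prod.cong)
  have sum: "sum a J = Suc (sum ?b J)"
    using False rest assms by (simp add: sum.remove[of J k])
  have prod: "(\<Prod>j\<in>J. fact (a j)) = a k * (\<Prod>j\<in>J. fact (?b j) :: nat)"
    using False rest assms by (simp add: prod.remove[of J k] fact_reduce)
  have "multinomial_coeff J ?b * sum a J * (\<Prod>j\<in>J. fact (?b j)) = fact (sum a J)"
    using multinomial_coeff_mult_prod_fact[OF assms(1), of ?b]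
    unfolding sum fact_Suc of_nat_id by (metis mult.assoc mult.commute)
  also have "\<dots> = multinomial_coeff J a * a k * (\<Prod>j\<in>J. fact (?b j))"
    using multinomial_coeff_mult_prod_fact[OF assms(1), of a] by (simp only: prod ac_simps)
  finally show ?thesis
    using False assms by (simp add: reduced_multinomial_def)
qed

lemma reduced_multinomial_notin:
  "k \<notin> J \<Longrightarrow> reduced_multinomial J k a = multinomial_coeff J a"
  by (auto simp: reduced_multinomial_def intro: multinomial_coeff_cong)

text \<open>For \<open>k\<close> in \<open>J\<close> with \<open>b k \<noteq> 0\<close>, the reduced
  coefficient is the ordinary one times \<open>b k / sum b J\<close>, a ratio that does not change
  when \<open>b\<close> is multiplied by \<open>p\<close>.\<close>

lemma reduced_multinomial_prime_mult:
  assumes "0 < p" "finite J"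
  shows "reduced_multinomial J k (\<lambda>j. p * b j) * (\<Prod>j\<in>J. fact_coprime_part p (p * b j))
    = reduced_multinomial J k b * fact_coprime_part p (p * sum b J)"
proof (cases "k \<in> J \<and> b k \<noteq> 0")
  case True
  let ?U = "\<Prod>j\<in>J. fact_coprime_part p (p * b j)"
  let ?V = "fact_coprime_part p (p * sum b J)"
  have "reduced_multinomial J k (\<lambda>j. p * b j) * ?U * (p * sum b J)
      = multinomial_coeff J (\<lambda>j. p * b j) * ?U * (p * b k)"
    using reduced_multinomial_mult_sum[of J k "\<lambda>j. p * b j"] assms True
    by (simp add: sum_distrib_left ac_simps)
  also have "\<dots> = reduced_multinomial J k b * ?V * (p * sum b J)"
    using reduced_multinomial_mult_sum[of J k b] multinomial_coeff_prime_mult[OF assms, of b] assms True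
    by (simp add: ac_simps)
  finally show ?thesis
    using assms True by auto
next
  case False
  then show ?thesis
    using multinomial_coeff_prime_mult[OF assms, of b]
    by (cases "k \<in> J") (auto simp: reduced_multinomial_notin, simp add: reduced_multinomial_def)
qed

text \<open>All \<open>p * b j\<close> are multiples of \<open>p ^ s\<close>, so \<open>U\<close>
  and \<open>V\<close> are congruent modulo \<open>p ^ s\<close> to the same power of
  \<open>fact_coprime_part p (p ^ s)\<close>. The divisibility of the coefficient raises the modulus
  to \<open>p ^ r\<close>, and \<open>U\<close>, being prime to \<open>p\<close>, cancels.\<close>

lemma reduced_multinomial_prime_mult_cong:
  assumes "prime p" "finite J" "0 < s" "s \<le> r"
    and b: "\<And>j. j \<in> J \<Longrightarrow> p ^ (s - 1) dvd b j"
    and dvd: "p ^ (r - s) dvd reduced_multinomial J k b"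
  shows "[int (reduced_multinomial J k (\<lambda>j. p * b j)) = int (reduced_multinomial J k b)] (mod int (p ^ r))"
proof -
  let ?T = "\<lambda>a. int (reduced_multinomial J k a)"
  define U where "U = (\<Prod>j\<in>J. fact_coprime_part p (p * b j))"
  define V where "V = fact_coprime_part p (p * sum b J)"
  have ps: "p ^ s = p * p ^ (s - 1)" using assms(3) by (cases s) auto
  obtain h where h: "\<And>j. j \<in> J \<Longrightarrow> b j = p ^ (s - 1) * h j"
    using b unfolding dvd_def by metis
  have V: "V = fact_coprime_part p (p ^ s * sum h J)"
    using h by (simp add: V_def ps sum_distrib_left mult.assoc)
  have "U = (\<Prod>j\<in>J. fact_coprime_part p (p ^ s * h j))"
    using h by (simp add: U_def ps mult.assoc)
  also have "[\<dots> = (\<Prod>j\<in>J. fact_coprime_part p (p ^ s) ^ h j)] (mod p ^ s)"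
    using assms(3) by (intro cong_prod fact_coprime_part_cong_power) simp
  also have "(\<Prod>j\<in>J. fact_coprime_part p (p ^ s) ^ h j) = fact_coprime_part p (p ^ s) ^ sum h J"
    by (simp add: power_sum)
  also have "[\<dots> = V] (mod p ^ s)"
    unfolding V using assms(3) by (intro cong_sym[OF fact_coprime_part_cong_power]) simp
  finally have "[int U = int V] (mod int (p ^ s))"
    by (simp only: cong_int_iff)
  then have "int (p ^ s) dvd int V - int U"
    by (metis cong_iff_dvd_diff cong_sym)
  then have "int (p ^ (r - s)) * int (p ^ s) dvd ?T b * (int V - int U)"
    using dvd by (intro mult_dvd_mono) (auto simp only: int_dvd_int_iff)
  moreover have "int (p ^ (r - s)) * int (p ^ s) = int (p ^ r)"
    using assms(4) by (simp flip: power_add)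
  moreover have "?T (\<lambda>j. p * b j) * int U = ?T b * int V"
    using reduced_multinomial_prime_mult[OF prime_gt_0_nat[OF assms(1)] assms(2), of k b]
    unfolding U_def V_def by (simp only: flip: of_nat_mult)
  then have "?T b * (int V - int U) = int U * (?T (\<lambda>j. p * b j) - ?T b)"
    by (simp add: algebra_simps)
  moreover have "coprime (int (p ^ r)) (int U)"
    using coprime_fact_coprime_part[OF assms(1)] unfolding U_def
    by (auto intro!: prod_coprime_right simp: coprime_commute[of p])
  ultimately have "int (p ^ r) dvd ?T (\<lambda>j. p * b j) - ?T b"
    using coprime_dvd_mult_right_iff by metis
  then show ?thesis
    by (simp add: cong_iff_dvd_diff)
qed

section \<open>Congruences between $p$-integral rationals\<close>

lemma p_integral_of_int: "prime p \<Longrightarrow> p_integral p (of_int a)"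
  unfolding p_integral_def by (intro exI[of _ a] exI[of _ 1]) (auto simp: zdvd1_eq)

lemma p_integral_of_nat: "prime p \<Longrightarrow> p_integral p (of_nat n)"
  using p_integral_of_int[of p "int n"] by simp

lemma p_integral_divide_int: "\<not> int p dvd b \<Longrightarrow> p_integral p (of_int a / of_int b)"
  unfolding p_integral_def by blast

lemma p_integral_mult:
  assumes "prime p" "p_integral p x" "p_integral p y"
  shows "p_integral p (x * y)"
proof -
  obtain a b c d where "\<not> int p dvd b" "x = of_int a / of_int b" "\<not> int p dvd d" "y = of_int c / of_int d"
    using assms by (auto simp: p_integral_def)
  moreover from this have "\<not> int p dvd b * d"
    using assms(1) by (simp add: prime_dvd_mult_iff)
  ultimately show ?thesis
    using p_integral_divide_int[of p "b * d" "a * c"] by simp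
qed

lemma p_integral_add:
  assumes "prime p" "p_integral p x" "p_integral p y"
  shows "p_integral p (x + y)"
proof -
  obtain a b c d where *: "\<not> int p dvd b" "x = of_int a / of_int b" "\<not> int p dvd d" "y = of_int c / of_int d"
    using assms by (auto simp: p_integral_def)
  moreover from this have "\<not> int p dvd b * d"
    using assms(1) by (simp add: prime_dvd_mult_iff)
  moreover have "b \<noteq> 0" "d \<noteq> 0" using * by auto
  ultimately show ?thesis
    using p_integral_divide_int[of p "b * d" "a * d + c * b"] by (simp add: add_frac_eq)
qed

lemma p_integral_sum:
  "prime p \<Longrightarrow> (\<And>i. i \<in> A \<Longrightarrow> p_integral p (f i)) \<Longrightarrow> p_integral p (sum f A)"
  by (induction A rule: infinite_finite_induct)
    (auto intro: p_integral_add p_integral_of_int[of p 0, simplified])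

lemma p_integral_power:
  "prime p \<Longrightarrow> p_integral p x \<Longrightarrow> p_integral p (x ^ n)"
  by (induction n) (auto intro: p_integral_mult p_integral_of_int[of p 1, simplified])

lemma p_integral_prod:
  "prime p \<Longrightarrow> (\<And>i. i \<in> A \<Longrightarrow> p_integral p (f i)) \<Longrightarrow> p_integral p (prod f A)"
  by (induction A rule: infinite_finite_induct)
    (auto intro: p_integral_mult p_integral_of_int[of p 1, simplified])

lemma cong_prime_power_refl: "prime p \<Longrightarrow> cong_prime_power p r x x"
  unfolding cong_prime_power_def
  by (rule exI[of _ 0]) (use p_integral_of_int[of p 0] in auto)

lemma cong_prime_power_add:
  assumes "prime p" "cong_prime_power p r x y" "cong_prime_power p r x' y'"
  shows "cong_prime_power p r (x + x') (y + y')"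
proof -
  obtain z z' where "p_integral p z" "x - y = of_nat (p ^ r) * z"
    "p_integral p z'" "x' - y' = of_nat (p ^ r) * z'"
    using assms by (auto simp: cong_prime_power_def)
  then show ?thesis
    unfolding cong_prime_power_def
    by (intro exI[of _ "z + z'"]) (auto simp: algebra_simps intro: p_integral_add assms(1))
qed

lemma cong_prime_power_trans:
  assumes "prime p" "cong_prime_power p r x y" "cong_prime_power p r y z"
  shows "cong_prime_power p r x z"
  using cong_prime_power_add[OF assms] by (simp add: cong_prime_power_def)

lemma cong_prime_power_mult_left:
  assumes "prime p" "p_integral p a" "cong_prime_power p r x y"
  shows "cong_prime_power p r (a * x) (a * y)"
proof -
  obtain z where z: "p_integral p z" "x - y = of_nat (p ^ r) * z"
    using assms by (auto simp: cong_prime_power_def)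
  have "a * x - a * y = of_nat (p ^ r) * (a * z)"
    using z(2) by (simp add: algebra_simps flip: right_diff_distrib)
  then show ?thesis
    using z(1) assms p_integral_mult unfolding cong_prime_power_def by blast
qed

lemma cong_prime_power_mult_right:
  "prime p \<Longrightarrow> p_integral p a \<Longrightarrow> cong_prime_power p r x y \<Longrightarrow>
    cong_prime_power p r (x * a) (y * a)"
  using cong_prime_power_mult_left[of p a r x y] by (simp add: mult.commute)

lemma cong_prime_power_mult:
  assumes "prime p" "p_integral p x'" "p_integral p y"
    and "cong_prime_power p r x y" "cong_prime_power p r x' y'"
  shows "cong_prime_power p r (x * x') (y * y')"
  using cong_prime_power_mult_left[OF assms(1,2,4)] cong_prime_power_mult_left[OF assms(1,3,5)]
  by (auto intro: cong_prime_power_trans[OF assms(1)] simp: mult.commute)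

lemma cong_prime_power_sum:
  "prime p \<Longrightarrow> (\<And>i. i \<in> A \<Longrightarrow> cong_prime_power p r (f i) (g i)) \<Longrightarrow>
    cong_prime_power p r (sum f A) (sum g A)"
  by (induction A rule: infinite_finite_induct)
    (auto intro: cong_prime_power_add cong_prime_power_refl)

lemma cong_prime_power_prod:
  assumes "prime p" "\<And>i. i \<in> A \<Longrightarrow> cong_prime_power p r (f i) (g i)"
    and "\<And>i. i \<in> A \<Longrightarrow> p_integral p (f i)" "\<And>i. i \<in> A \<Longrightarrow> p_integral p (g i)"
  shows "cong_prime_power p r (prod f A) (prod g A)"
  using assms
  by (induction A rule: infinite_finite_induct)
    (auto intro!: cong_prime_power_mult cong_prime_power_refl p_integral_prod)

lemma cong_prime_power_power:
  assumes "prime p" "p_integral p x" "p_integral p y" "cong_prime_power p r x y"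
  shows "cong_prime_power p r (x ^ n) (y ^ n)"
  using cong_prime_power_prod[of p "{..<n}" r "\<lambda>_. x" "\<lambda>_. y"] assms by simp

lemma cong_prime_power_of_int:
  assumes "prime p" "[a = b] (mod int (p ^ r))"
  shows "cong_prime_power p r (of_int a) (of_int b)"
proof -
  obtain c where "a - b = int (p ^ r) * c"
    using assms(2) by (auto simp: cong_iff_dvd_diff)
  then have "(of_int a - of_int b :: rat) = of_nat (p ^ r) * of_int c"
    by (metis of_int_diff of_int_mult of_int_of_nat_eq)
  then show ?thesis
    using p_integral_of_int[OF assms(1)] unfolding cong_prime_power_def by blast
qed

lemma cong_prime_power_mult_dvd:
  assumes "prime p" "p ^ (r - s) dvd n" "s \<le> r" "cong_prime_power p s x y"
  shows "cong_prime_power p r (of_nat n * x) (of_nat n * y)"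
proof -
  obtain m where m: "n = p ^ (r - s) * m"
    using assms(2) by (auto elim: dvdE)
  obtain z where z: "p_integral p z" "x - y = of_nat (p ^ s) * z"
    using assms(4) by (auto simp: cong_prime_power_def)
  have "of_nat n * x - of_nat n * y = (of_nat (p ^ (r - s) * p ^ s) * (of_nat m * z) :: rat)"
    by (simp only: m right_diff_distrib[symmetric] z(2) of_nat_mult) (simp only: ac_simps)
  then have "of_nat n * x - of_nat n * y = (of_nat (p ^ r) * (of_nat m * z) :: rat)"
    using assms(3) by (simp flip: power_add)
  moreover have "p_integral p (of_nat m * z)"
    using z assms(1) by (intro p_integral_mult p_integral_of_nat)
  ultimately show ?thesis
    unfolding cong_prime_power_def by blast
qed

text \<open>With \<open>n = p ^ (s - 1) * h\<close> the two exponents differ by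
  \<open>totient (p ^ s) * h\<close>, so Euler's theorem for \<open>x\<close> and \<open>y\<close>
  gives the claim.\<close>

lemma cong_prime_power_prime_exponent:
  assumes "prime p" "0 < s" "\<not> int p dvd x" "\<not> int p dvd y" "p ^ (s - 1) dvd n"
  defines "c \<equiv> of_int x / of_int y :: rat"
  shows "cong_prime_power p s (c ^ (p * n)) (c ^ n)"
proof -
  let ?t = "totient (p ^ s)"
  \<comment> \<open>Euler's theorem is applied to natural numbers, so \<open>z\<close> is replaced
    by its nonnegative residue.\<close>
  have unit: "[z ^ ?t = 1] (mod int (p ^ s))" if "\<not> int p dvd z" for z
  proof -
    have "coprime (int p) z"
      using that assms(1) by (intro prime_imp_coprime) auto
    then have "coprime z (int (p ^ s))"
      by (simp add: coprime_commute)
    moreover have pos: "int (p ^ s) > 0"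
      using assms(1) by (simp add: prime_gt_0_nat)
    ultimately have "coprime (int (nat (z mod int (p ^ s)))) (int (p ^ s))"
      by (simp add: coprime_mod_left_iff del: of_nat_power)
    then have "[nat (z mod int (p ^ s)) ^ ?t = 1] (mod p ^ s)"
      by (intro euler_theorem) (simp only: coprime_int_iff)
    then have "[int (nat (z mod int (p ^ s))) ^ ?t = 1] (mod int (p ^ s))"
      by (metis cong_int_iff of_nat_1 of_nat_power)
    then show ?thesis
      using assms(1) by (simp add: cong_def mod_simps prime_gt_0_nat)
  qed
  have "[x ^ ?t = y ^ ?t] (mod int (p ^ s))"
    using unit[OF assms(3)] unit[OF assms(4)] by (metis cong_sym cong_trans)
  then have "cong_prime_power p s (of_int (x ^ ?t)) (of_int (y ^ ?t))"
    by (rule cong_prime_power_of_int[OF assms(1)])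
  moreover have "p_integral p (1 / of_int (y ^ ?t))"
    using p_integral_divide_int[of p "y ^ ?t" 1] assms(1,4) prime_dvd_power[of "int p" y ?t] by auto
  moreover have "y \<noteq> 0" using assms(4) by auto
  ultimately have one: "cong_prime_power p s (c ^ ?t) 1"
    using cong_prime_power_mult_left[of p "1 / of_int (y ^ ?t)" s "of_int (x ^ ?t)" "of_int (y ^ ?t)"] assms(1)
    by (simp add: c_def power_divide)
  have c: "p_integral p c"
    unfolding c_def using assms(4) by (rule p_integral_divide_int)
  obtain h where h: "n = p ^ (s - 1) * h"
    using assms(5) by (auto elim: dvdE)
  have "p * n = n + ?t * h"
    using assms(1,2) prime_gt_0_nat[OF assms(1)]
    by (simp add: totient_prime_power h algebra_simps)
  then have "c ^ (p * n) = c ^ n * (c ^ ?t) ^ h"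
    by (simp add: power_add power_mult)
  moreover have "cong_prime_power p s ((c ^ ?t) ^ h) (1 ^ h)"
    using one c assms(1) p_integral_of_int[of p 1]
    by (intro cong_prime_power_power p_integral_power) auto
  then have "cong_prime_power p s (c ^ n * (c ^ ?t) ^ h) (c ^ n * 1 ^ h)"
    using c assms(1) by (intro cong_prime_power_mult_left p_integral_power)
  ultimately show ?thesis by simp
qed

section \<open>The expansion at a vertex\<close>

lemma single_power:
  fixes c :: "'a::comm_semiring_1" and d :: "int ^ 'n"
  shows "Poly_Mapping.single d c ^ m = Poly_Mapping.single (int m *s d) (c ^ m)"
proof (induction m)
  case 0
  have "int 0 *s d = 0" by (simp add: vec_eq_iff)
  then show ?case by simp
next
  case (Suc m)
  have "d + int m *s d = int (Suc m) *s d"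
    by (simp add: vec_eq_iff algebra_simps)
  with Suc show ?case by (simp add: mult_single)
qed

lemma real_exponent_diff: "real_exponent (k - k') = real_exponent k - real_exponent k'"
  by (simp add: real_exponent_def vec_eq_iff)

lemma real_exponent_zero: "real_exponent 0 = 0"
  by (simp add: real_exponent_def vec_eq_iff)

lemma real_exponent_scale: "real_exponent (int p *s k) = real p *\<^sub>R real_exponent k"
  by (simp add: real_exponent_def vec_eq_iff)

lemma inj_real_exponent: "real_exponent k = real_exponent l \<Longrightarrow> k = l"
  by (simp add: real_exponent_def vec_eq_iff)

lemma prod_single:
  fixes c :: "'b \<Rightarrow> 'a::comm_semiring_1" and d :: "'b \<Rightarrow> 'c::comm_monoid_add"
  shows "finite J \<Longrightarrow> (\<Prod>j\<in>J. Poly_Mapping.single (d j) (c j)) = Poly_Mapping.single (sum d J) (prod c J)"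
  by (induction J rule: finite_induct) (simp_all add: mult_single)

text \<open>
  \<open>E j\<close> records the coordinates in which \<open>j\<close> differs from \<open>v\<close>: since the exponents are 0 or 1, the
  \<open>i\<close>-th coordinate of \<open>j - v\<close> has the same sign \<open>1 - 2 * v $ i\<close> for all \<open>j\<close> for which it is nonzero.
\<close>

locale linear_polynomial_vertex =
  fixes Q :: "('n::finite, int) laurent_poly" and v :: "int ^ 'n"
  assumes linear: "linear_in_each_variable Q" and v_key: "v \<in> Poly_Mapping.keys Q"
begin

definition J :: "(int ^ 'n) set" where
  "J = Poly_Mapping.keys Q - {v}"

text \<open>For \<open>j\<close> in \<open>J\<close> this is the coefficient of
  \<open>geometric_base Q v\<close> at \<open>j - v\<close>.\<close>

definition c :: "int ^ 'n \<Rightarrow> rat" where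
  "c j = - of_int (Poly_Mapping.lookup Q j) / of_int (Poly_Mapping.lookup Q v)"

definition monom_coeff :: "(int ^ 'n \<Rightarrow> nat) \<Rightarrow> rat" where
  "monom_coeff a = (\<Prod>j\<in>J. c j ^ a j)"

definition E :: "int ^ 'n \<Rightarrow> 'n set" where
  "E j = {i. j $ i \<noteq> v $ i}"

definition representations :: "int ^ 'n \<Rightarrow> (int ^ 'n \<Rightarrow> nat) set" where
  "representations u = {a. (\<forall>j. j \<notin> J \<longrightarrow> a j = 0) \<and> (\<Sum>j\<in>J. int (a j) *s (j - v)) = u}"

lemma finite_J: "finite J" and v_notin_J: "v \<notin> J" and insert_v_J: "insert v J = Poly_Mapping.keys Q"
  using v_key by (auto simp: J_def)

lemma E_v: "E v = {}" by (simp add: E_def)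

text \<open>A coordinate that differs from \<open>v $ i\<close> has only one possible value left in
  \<open>{0, 1}\<close>.\<close>

lemma inj_on_E: "inj_on E (Poly_Mapping.keys Q)"
proof (rule inj_onI)
  fix j k assume jk: "j \<in> Poly_Mapping.keys Q" "k \<in> Poly_Mapping.keys Q" "E j = E k"
  have "j $ i = k $ i" for i
  proof -
    have "j $ i \<in> {0, 1}" "k $ i \<in> {0, 1}" "v $ i \<in> {0, 1}"
      using linear jk v_key by (auto simp: linear_in_each_variable_def)
    moreover have "j $ i \<noteq> v $ i \<longleftrightarrow> k $ i \<noteq> v $ i"
      using jk(3) by (auto simp: E_def)
    ultimately show ?thesis by auto
  qed
  then show "j = k" by (simp add: vec_eq_iff)
qed

lemma diff_component:
  assumes "j \<in> J"
  shows "(1 - 2 * v $ i) * (j - v) $ i = of_bool (i \<in> E j)"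
proof -
  have "j $ i \<in> {0, 1}" "v $ i \<in> {0, 1}"
    using linear assms v_key by (auto simp: linear_in_each_variable_def J_def)
  then show ?thesis by (auto simp: E_def)
qed

text \<open>The common sign of the \<open>i\<close>-th coordinates prevents cancellation. This turns
  divisibility of \<open>u\<close> by \<open>p ^ r\<close> into the hypothesis of
  \<open>prime_power_dvd_reduced_multinomial\<close>.\<close>

lemma incidence_sum:
  assumes "a \<in> representations u"
  shows "int (\<Sum>j\<in>{j\<in>J. i \<in> E j}. a j) = (1 - 2 * v $ i) * u $ i"
proof -
  have "(1 - 2 * v $ i) * u $ i = (1 - 2 * v $ i) * (\<Sum>j\<in>J. int (a j) *s (j - v)) $ i"
    using assms by (simp add: representations_def)
  also have "\<dots> = (\<Sum>j\<in>J. int (a j) * ((1 - 2 * v $ i) * (j - v) $ i))"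
    unfolding sum_component sum_distrib_left by (intro sum.cong) (simp_all add: algebra_simps)
  also have "\<dots> = (\<Sum>j\<in>J. int (a j) * of_bool (i \<in> E j))"
    by (intro sum.cong refl) (simp only: diff_component)
  also have "\<dots> = (\<Sum>j\<in>{j\<in>J. i \<in> E j}. int (a j))"
    by (rule sum.mono_neutral_cong_right) (auto simp: finite_J)
  finally show ?thesis by simp
qed

text \<open>Each \<open>j\<close> in \<open>J\<close> differs from \<open>v\<close> at some
  \<open>i\<close>, and the incidence sum at \<open>i\<close>, at most
  \<open>\<bar>u $ i\<bar>\<close>, bounds \<open>a j\<close>.\<close>

lemma finite_representations: "finite (representations u)"
proof (rule finite_subset)
  let ?N = "nat (\<Sum>i\<in>UNIV. \<bar>u $ i\<bar>)"
  show "representations u \<subseteq> {a. \<forall>j. (j \<in> J \<longrightarrow> a j \<in> {..?N}) \<and> (j \<notin> J \<longrightarrow> a j = 0)}"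
  proof (intro subsetI CollectI allI conjI impI)
    fix a j assume a: "a \<in> representations u" and j: "j \<in> J"
    then have "j \<noteq> v" using v_notin_J by auto
    then obtain i where i: "i \<in> E j" by (auto simp: E_def vec_eq_iff)
    have v: "v $ i \<in> {0, 1}"
      using linear v_key by (auto simp: linear_in_each_variable_def)
    have "int (a j) \<le> int (\<Sum>j\<in>{j\<in>J. i \<in> E j}. a j)"
      using i j finite_J by (intro of_nat_mono member_le_sum) auto
    also have "\<dots> \<le> \<bar>u $ i\<bar>"
      using v unfolding incidence_sum[OF a] by auto
    also have "\<dots> \<le> (\<Sum>i\<in>UNIV. \<bar>u $ i\<bar>)"
      by (intro member_le_sum) auto
    finally show "a j \<in> {..?N}" by simp
  qed (auto simp: representations_def)
  show "finite {a. \<forall>j. (j \<in> J \<longrightarrow> a j \<in> {..?N}) \<and> (j \<notin> J \<longrightarrow> a j = (0::nat))}"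
    using finite_J by (intro finite_set_of_finite_funs) auto
qed

section \<open>Coefficients of the expansion as sums over representations\<close>

lemma lookup_geometric_base_power:
  "Poly_Mapping.lookup (geometric_base Q v ^ m) u =
    (\<Sum>a\<in>{a \<in> representations u. sum a J = m}. of_nat (multinomial_coeff J a) * monom_coeff a)"
proof -
  let ?B = "\<Sum>j\<in>J. Poly_Mapping.single (j - v) (c j)"
  let ?e = "\<lambda>a. \<Sum>j\<in>J. int (a j) *s (j - v)"
  have B: "geometric_base Q v = ?B"
    by (simp add: geometric_base_def J_def c_def single_uminus sum_negf)
  have "?B ^ m = (\<Sum>a\<in>compositions J m. of_nat (multinomial_coeff J a) *
      (\<Prod>j\<in>J. Poly_Mapping.single (j - v) (c j) ^ a j))"
    by (rule multinomial_theorem[OF finite_J])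
  also have "\<dots> = (\<Sum>a\<in>compositions J m.
      Poly_Mapping.single (?e a) (of_nat (multinomial_coeff J a) * monom_coeff a))"
    by (simp add: single_power prod_single finite_J monom_coeff_def mult_single flip: single_of_nat)
  finally have "Poly_Mapping.lookup (geometric_base Q v ^ m) u = (\<Sum>a\<in>compositions J m.
      if ?e a = u then of_nat (multinomial_coeff J a) * monom_coeff a else 0)"
    by (simp add: B lookup_sum lookup_single when_def)
  also have "\<dots> = (\<Sum>a\<in>{a \<in> representations u. sum a J = m}.
      of_nat (multinomial_coeff J a) * monom_coeff a)"
    by (rule sum.mono_neutral_cong_right)
      (use finite_compositions[OF finite_J] in \<open>auto simp: compositions_def representations_def\<close>)
  finally show ?thesis .
qed

text \<open>A representation \<open>a\<close> occurs in exactly one power of the geometric base,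
  that with exponent \<open>sum a J\<close>. The powers left out by \<open>inverse_expansion\<close>
  contribute 0.\<close>

lemma inverse_expansion_eq:
  "inverse_expansion Q v u =
    (\<Sum>a\<in>representations u. of_nat (multinomial_coeff J a) * monom_coeff a)
      / of_int (Poly_Mapping.lookup Q v)"
proof -
  let ?g = "\<lambda>a. of_nat (multinomial_coeff J a) * monom_coeff a"
  let ?S = "\<lambda>m. \<Sum>a\<in>{a \<in> representations u. sum a J = m}. ?g a"
  have sub: "{m. ?S m \<noteq> 0} \<subseteq> (\<lambda>a. sum a J) ` representations u"
  proof
    fix m assume "m \<in> {m. ?S m \<noteq> 0}"
    then have "{a \<in> representations u. sum a J = m} \<noteq> {}" by force
    then show "m \<in> (\<lambda>a. sum a J) ` representations u" by auto
  qed
  have "(\<Sum>m\<in>{m. ?S m \<noteq> 0}. ?S m) = (\<Sum>m\<in>(\<lambda>a. sum a J) ` representations u. ?S m)"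
    using sub by (intro sum.mono_neutral_left) (auto simp: finite_representations)
  also have "\<dots> = sum ?g (representations u)"
    by (rule sum.image_gen[symmetric]) (rule finite_representations)
  finally show ?thesis
    by (simp add: inverse_expansion_def lookup_geometric_base_power)
qed

definition gauss_sum :: "int ^ 'n \<Rightarrow> int ^ 'n \<Rightarrow> rat" where
  "gauss_sum k u =
    (\<Sum>a\<in>representations u. of_nat (reduced_multinomial J k a) * monom_coeff a)"

lemma lookup_nonzero: "j \<in> Poly_Mapping.keys Q \<Longrightarrow> Poly_Mapping.lookup Q j \<noteq> 0"
  by (simp add: in_keys_iff)

text \<open>For \<open>k \<noteq> v\<close>, lowering \<open>a k\<close> by 1 maps the
  representations of \<open>u\<close> with \<open>a k \<noteq> 0\<close> bijectively onto those of
  \<open>u - (k - v)\<close>. The factor \<open>c k\<close> split off from the monomial turns the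
  constant \<open>1 / q_v\<close> into \<open>- 1 / q_k\<close>.\<close>

lemma inverse_expansion_shift:
  assumes "k \<in> Poly_Mapping.keys Q"
  shows "inverse_expansion Q v (u - (k - v)) =
    (if k = v then 1 else - 1) / of_int (Poly_Mapping.lookup Q k) * gauss_sum k u"
proof (cases "k = v")
  case True
  then show ?thesis
    using v_notin_J by (simp add: inverse_expansion_eq gauss_sum_def reduced_multinomial_notin)
next
  case False
  then have k: "k \<in> J" using assms by (simp add: J_def)
  have c: "c k \<noteq> 0" using assms v_key by (simp add: c_def lookup_nonzero)
  let ?e = "\<lambda>a. \<Sum>j\<in>J. int (a j) *s (j - v)"
  have Suc: "int (Suc n) *s x = int n *s x + x" for n and x :: "int ^ 'n"
    by (simp add: vec_eq_iff algebra_simps)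
  have e: "?e (a(k := Suc (a k))) = ?e a + (k - v)" for a
  proof -
    have "?e (a(k := Suc (a k))) = (\<Sum>j\<in>J. int (a j) *s (j - v) + (if j = k then k - v else 0))"
      by (intro sum.cong) (auto simp: Suc simp del: of_nat_Suc)
    also have "\<dots> = ?e a + (k - v)"
      using k finite_J by (simp add: sum.distrib)
    finally show ?thesis .
  qed
  have monom: "monom_coeff (a(k := Suc (a k))) = c k * monom_coeff a" for a
  proof -
    have "monom_coeff (a(k := Suc (a k))) = (\<Prod>j\<in>J. c j ^ a j * (if j = k then c k else 1))"
      unfolding monom_coeff_def by (intro prod.cong) auto
    also have "\<dots> = c k * monom_coeff a"
      using k finite_J by (simp add: prod.distrib monom_coeff_def)
    finally show ?thesis .
  qed
  have rep: "a(k := Suc (a k)) \<in> representations u \<longleftrightarrow> a \<in> representations (u - (k - v))" for a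
    using k e[of a] by (auto simp: representations_def algebra_simps)
  let ?g = "\<lambda>a. of_nat (reduced_multinomial J k a) * monom_coeff a"
  have "gauss_sum k u = sum ?g {a \<in> representations u. a k \<noteq> 0}"
    unfolding gauss_sum_def using k finite_representations
    by (intro sum.mono_neutral_right) (auto simp: reduced_multinomial_def)
  also have "\<dots> = (\<Sum>a\<in>representations (u - (k - v)).
      of_nat (multinomial_coeff J a) * (c k * monom_coeff a))"
  proof (rule sum.reindex_bij_witness[where j = "\<lambda>a. a(k := a k - 1)" and i = "\<lambda>a. a(k := Suc (a k))"])
    fix a assume a: "a \<in> {a \<in> representations u. a k \<noteq> 0}"
    define b where "b = a(k := a k - 1)"
    have ab: "a = b(k := Suc (b k))" using a by (auto simp: b_def)
    show "a(k := a k - 1, k := Suc ((a(k := a k - 1)) k)) = a"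
      using a by auto
    show "a(k := a k - 1) \<in> representations (u - (k - v))"
      using a rep[of b] unfolding b_def[symmetric] by (simp flip: ab)
    show "of_nat (multinomial_coeff J (a(k := a k - 1))) * (c k * monom_coeff (a(k := a k - 1))) = ?g a"
      using a monom[of b] unfolding b_def[symmetric]
      by (simp add: reduced_multinomial_def b_def[symmetric, simplified] flip: ab)
  next
    fix a assume "a \<in> representations (u - (k - v))"
    then show "a(k := Suc (a k)) \<in> {a \<in> representations u. a k \<noteq> 0}"
      using rep by simp
  qed simp
  also have "\<dots> = c k * of_int (Poly_Mapping.lookup Q v) * inverse_expansion Q v (u - (k - v))"
    using lookup_nonzero[OF v_key]
    by (simp add: inverse_expansion_eq mult.left_commute[of _ "c k"] flip: sum_distrib_left)
  also have "c k * of_int (Poly_Mapping.lookup Q v) = - of_int (Poly_Mapping.lookup Q k)"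
    using v_key by (simp add: c_def lookup_nonzero)
  finally show ?thesis
    using False assms by (simp add: lookup_nonzero)
qed

section \<open>Gauss congruences at primes dividing no coefficient in the support\<close>

lemma p_integral_c:
  assumes "\<not> int p dvd Poly_Mapping.lookup Q v"
  shows "p_integral p (c j)"
  using p_integral_divide_int[OF assms, of "- Poly_Mapping.lookup Q j"] by (simp add: c_def)

lemma p_integral_monom_coeff:
  "prime p \<Longrightarrow> \<not> int p dvd Poly_Mapping.lookup Q v \<Longrightarrow> p_integral p (monom_coeff a)"
  unfolding monom_coeff_def by (intro p_integral_prod p_integral_power p_integral_c)

lemma p_integral_gauss_sum:
  "prime p \<Longrightarrow> \<not> int p dvd Poly_Mapping.lookup Q v \<Longrightarrow> p_integral p (gauss_sum k u)"
  unfolding gauss_sum_def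
  by (intro p_integral_sum p_integral_mult p_integral_of_nat p_integral_monom_coeff)

lemma prime_power_dvd_term:
  assumes "prime p" "k \<in> Poly_Mapping.keys Q" "a \<in> representations (int (p ^ r) *s m)"
    and "l \<in> J" "\<not> p ^ Suc s dvd a l"
  shows "p ^ (r - s) dvd reduced_multinomial J k a"
proof (rule prime_power_dvd_reduced_multinomial[where E = E and v = v])
  fix i
  have "int (p ^ r) dvd int (\<Sum>j\<in>{j\<in>J. i \<in> E j}. a j)"
    unfolding incidence_sum[OF assms(3)] by simp
  then show "p ^ r dvd (\<Sum>j\<in>{j\<in>J. i \<in> E j}. a j)"
    by (simp only: int_dvd_int_iff)
qed (use inj_on_E assms finite_J v_notin_J E_v in \<open>simp_all add: insert_v_J\<close>)

lemma prime_mult_in_representations: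
  assumes "0 < p"
  shows "(\<lambda>j. p * b j) \<in> representations (int p *s u) \<longleftrightarrow> b \<in> representations u"
proof -
  have "(\<Sum>j\<in>J. int (p * b j) *s (j - v)) = int p *s (\<Sum>j\<in>J. int (b j) *s (j - v))"
    by (simp add: vec_eq_iff sum_distrib_left mult.assoc right_diff_distrib)
  moreover have "int p *s x = int p *s u \<longleftrightarrow> x = u" for x :: "int ^ 'n"
    using assms by (auto simp: vec_eq_iff)
  ultimately show ?thesis
    using assms by (auto simp: representations_def)
qed

text \<open>Take the largest \<open>s \<le> r\<close> such that \<open>p ^ (s - 1)\<close> divides
  \<open>b\<close> on \<open>J\<close>. The monomials then agree modulo \<open>p ^ s\<close>, and
  the missing factor \<open>p ^ (r - s)\<close> divides the reduced coefficient.\<close>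

lemma term_cong:
  assumes "prime p" "k \<in> Poly_Mapping.keys Q" "0 < r"
    and unit: "\<And>j. j \<in> Poly_Mapping.keys Q \<Longrightarrow> \<not> int p dvd Poly_Mapping.lookup Q j"
    and b: "b \<in> representations (int (p ^ (r - 1)) *s m)"
  shows "cong_prime_power p r
    (of_nat (reduced_multinomial J k (\<lambda>j. p * b j)) * monom_coeff (\<lambda>j. p * b j))
    (of_nat (reduced_multinomial J k b) * monom_coeff b)"
proof -
  have "\<exists>s. 0 < s \<and> s \<le> r \<and> (\<forall>j\<in>J. p ^ (s - 1) dvd b j) \<and> p ^ (r - s) dvd reduced_multinomial J k b"
  proof -
    \<comment> \<open>The cap \<open>s \<le> r\<close> makes the maximum exist even if
      \<open>b\<close> vanishes on \<open>J\<close>.\<close>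
    define P where "P s \<longleftrightarrow> 0 < s \<and> s \<le> r \<and> (\<forall>j\<in>J. p ^ (s - 1) dvd b j)" for s
    define s where "s = (GREATEST s. P s)"
    have "P 1" using assms(3) by (simp add: P_def)
    then have "P s"
      unfolding s_def by (rule GreatestI_nat[of P 1 r]) (simp add: P_def)
    moreover have "p ^ (r - s) dvd reduced_multinomial J k b"
    proof (cases "s = r")
      case False
      have "\<not> P (Suc s)"
      proof
        assume "P (Suc s)"
        then have "Suc s \<le> s"
          by (subst (2) s_def, intro Greatest_le_nat[of P _ r]) (auto simp: P_def)
        then show False by simp
      qed
      then obtain l where l: "l \<in> J" "\<not> p ^ Suc (s - 1) dvd b l"
        using \<open>P s\<close> False unfolding P_def by (metis Suc_pred' diff_Suc_1 le_neq_implies_less less_eq_Suc_le zero_less_Suc)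
      \<comment> \<open>The vector represented by \<open>b\<close> is only known to be a multiple of
        \<open>p ^ (r - 1)\<close>; as \<open>s\<close> is lowered by one too, the difference is
        still \<open>r - s\<close>.\<close>
      then have "p ^ (r - 1 - (s - 1)) dvd reduced_multinomial J k b"
        by (rule prime_power_dvd_term[OF assms(1,2) b])
      then show ?thesis using \<open>P s\<close> by (simp add: P_def)
    qed simp
    ultimately show ?thesis by (auto simp: P_def)
  qed
  then obtain s where s: "0 < s" "s \<le> r" "\<And>j. j \<in> J \<Longrightarrow> p ^ (s - 1) dvd b j"
    "p ^ (r - s) dvd reduced_multinomial J k b" by blast
  have v: "\<not> int p dvd Poly_Mapping.lookup Q v" using unit v_key by blast
  have "cong_prime_power p s (c j ^ (p * b j)) (c j ^ b j)" if "j \<in> J" for j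
    using cong_prime_power_prime_exponent[of p s "- Poly_Mapping.lookup Q j" "Poly_Mapping.lookup Q v" "b j"]
      that s assms(1) unit[of j] v by (simp add: c_def J_def)
  then have "cong_prime_power p s (monom_coeff (\<lambda>j. p * b j)) (monom_coeff b)"
    unfolding monom_coeff_def using assms(1) v
    by (intro cong_prime_power_prod p_integral_power p_integral_c)
  then have "cong_prime_power p r (of_nat (reduced_multinomial J k b) * monom_coeff (\<lambda>j. p * b j))
      (of_nat (reduced_multinomial J k b) * monom_coeff b)"
    by (rule cong_prime_power_mult_dvd[OF assms(1) s(4,2)])
  moreover have "cong_prime_power p r (of_int (int (reduced_multinomial J k (\<lambda>j. p * b j))))
      (of_int (int (reduced_multinomial J k b)))"
    by (intro cong_prime_power_of_int assms(1) reduced_multinomial_prime_mult_cong[OF _ finite_J s])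
  from cong_prime_power_mult_right[OF assms(1) p_integral_monom_coeff[OF assms(1) v] this]
  have "cong_prime_power p r
      (of_nat (reduced_multinomial J k (\<lambda>j. p * b j)) * monom_coeff (\<lambda>j. p * b j))
      (of_nat (reduced_multinomial J k b) * monom_coeff (\<lambda>j. p * b j))"
    by (simp only: of_int_of_nat_eq)
  ultimately show ?thesis
    by (rule cong_prime_power_trans[OF assms(1), rotated])
qed

lemma gauss_sum_cong:
  assumes "prime p" "k \<in> Poly_Mapping.keys Q" "0 < r"
    and unit: "\<And>j. j \<in> Poly_Mapping.keys Q \<Longrightarrow> \<not> int p dvd Poly_Mapping.lookup Q j"
  shows "cong_prime_power p r (gauss_sum k (int (p ^ r) *s m)) (gauss_sum k (int (p ^ (r - 1)) *s m))"
proof -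
  let ?R = "representations (int (p ^ r) *s m)"
  let ?R' = "representations (int (p ^ (r - 1)) *s m)"
  let ?g = "\<lambda>a. of_nat (reduced_multinomial J k a) * monom_coeff a"
  let ?D = "{a \<in> ?R. \<forall>j\<in>J. p dvd a j}"
  have p: "0 < p" using assms(1) by (rule prime_gt_0_nat)
  have v: "\<not> int p dvd Poly_Mapping.lookup Q v" using unit v_key by blast
  have "int (p ^ r) *s m = int p *s (int (p ^ (r - 1)) *s m)"
    using assms(3) by (cases r) (auto simp: vec_eq_iff)
  then have rep: "(\<lambda>j. p * b j) \<in> ?R \<longleftrightarrow> b \<in> ?R'" for b
    by (simp only: prime_mult_in_representations[OF p])
  have "(\<Sum>b\<in>?R'. ?g (\<lambda>j. p * b j)) = sum ?g ?D"
  proof (rule sum.reindex_bij_witness[where i = "\<lambda>a j. a j div p" and j = "\<lambda>b j. p * b j"])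
    fix a assume a: "a \<in> ?D"
    \<comment> \<open>Outside \<open>J\<close> the entries of \<open>a\<close> are 0, so the
      identity holds there as well.\<close>
    then show eq: "(\<lambda>j. p * (a j div p)) = a"
      by (auto simp: representations_def fun_eq_iff) (metis dvd_mult_div_cancel div_0 mult_0_right)
    show "(\<lambda>j. a j div p) \<in> ?R'"
      using a rep[of "\<lambda>j. a j div p"] unfolding eq by simp
  qed (use rep p in auto)
  moreover have "cong_prime_power p r (\<Sum>b\<in>?R'. ?g (\<lambda>j. p * b j)) (sum ?g ?R')"
    by (intro cong_prime_power_sum assms(1) term_cong assms)
  moreover have "cong_prime_power p r (sum ?g (?R - ?D)) (\<Sum>a\<in>?R - ?D. 0)"
  proof (rule cong_prime_power_sum[OF assms(1)])
    fix a assume a: "a \<in> ?R - ?D"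
    then obtain l where l: "l \<in> J" "\<not> p ^ Suc 0 dvd a l" by auto
    \<comment> \<open>An entry prime to \<open>p\<close> is the case \<open>s = 0\<close>, which
      gives the full power \<open>p ^ r\<close>.\<close>
    have "p ^ r dvd reduced_multinomial J k a"
      using prime_power_dvd_term[of p k a r m l 0] assms(1,2) l a by simp
    then have "[int (reduced_multinomial J k a) = 0] (mod int (p ^ r))"
      by (simp only: cong_0_iff int_dvd_int_iff)
    then have "cong_prime_power p r (of_int (int (reduced_multinomial J k a))) (of_int 0)"
      by (rule cong_prime_power_of_int[OF assms(1)])
    from cong_prime_power_mult_right[OF assms(1) p_integral_monom_coeff[OF assms(1) v] this]
    show "cong_prime_power p r (?g a) 0"
      by (simp only: of_int_of_nat_eq of_int_0 mult_zero_left)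
  qed
  moreover have "gauss_sum k (int (p ^ r) *s m) = sum ?g ?D + sum ?g (?R - ?D)"
    unfolding gauss_sum_def
    by (rule sum.subset_diff[OF _ finite_representations, THEN trans]) (auto simp: add.commute)
  ultimately show ?thesis
    using cong_prime_power_add[OF assms(1)] unfolding gauss_sum_def by fastforce
qed

text \<open>Only the finitely many primes dividing some coefficient in the support of
  \<open>Q\<close> are excluded. For the others the constants \<open>1 / q_k\<close> are p-integral
  and the \<open>c j\<close> with \<open>j\<close> in \<open>J\<close> are p-adic units.\<close>

lemma series_gauss_property_laurent_expansion:
  assumes "Poly_Mapping.keys P \<subseteq> Poly_Mapping.keys Q"
  shows "series_gauss_property (laurent_expansion P Q v)"
proof -
  let ?d = "\<lambda>k. of_int (Poly_Mapping.lookup P k) *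
    ((if k = v then 1 else - 1) / of_int (Poly_Mapping.lookup Q k)) :: rat"
  have expansion: "laurent_expansion P Q v u = (\<Sum>k\<in>Poly_Mapping.keys P. ?d k * gauss_sum k u)" for u
    unfolding laurent_expansion_def
  proof (intro sum.cong refl)
    fix k assume "k \<in> Poly_Mapping.keys P"
    with assms have "k \<in> Poly_Mapping.keys Q" by blast
    then show "of_int (Poly_Mapping.lookup P k) * inverse_expansion Q v (u - (k - v)) = ?d k * gauss_sum k u"
      by (simp only: inverse_expansion_shift mult.assoc)
  qed
  have good: "gauss_congruences p (laurent_expansion P Q v)"
    if p: "prime p" and unit: "\<And>j. j \<in> Poly_Mapping.keys Q \<Longrightarrow> \<not> int p dvd Poly_Mapping.lookup Q j" for p
  proof -
    have d: "p_integral p (?d k)" if "k \<in> Poly_Mapping.keys P" for k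
    proof -
      have "p_integral p (of_int (Poly_Mapping.lookup P k * (if k = v then 1 else - 1)) / of_int (Poly_Mapping.lookup Q k))"
        using that assms unit by (intro p_integral_divide_int) auto
      then show ?thesis by (simp split: if_splits)
    qed
    have v: "\<not> int p dvd Poly_Mapping.lookup Q v" using unit v_key by blast
    show ?thesis
      unfolding gauss_congruences_def expansion
    proof (intro conjI allI impI)
      show "p_integral p (\<Sum>k\<in>Poly_Mapping.keys P. ?d k * gauss_sum k u)" for u
        by (intro p_integral_sum p_integral_mult d p_integral_gauss_sum p v)
      show "cong_prime_power p r (\<Sum>k\<in>Poly_Mapping.keys P. ?d k * gauss_sum k (int (p ^ r) *s m))
          (\<Sum>k\<in>Poly_Mapping.keys P. ?d k * gauss_sum k (int (p ^ (r - 1)) *s m))" if "1 \<le> r" for m r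
        using that assms
        by (intro cong_prime_power_sum cong_prime_power_mult_left d p gauss_sum_cong unit) auto
    qed
  qed
  have "{p. prime p \<and> \<not> gauss_congruences p (laurent_expansion P Q v)}
      \<subseteq> (\<Union>j\<in>Poly_Mapping.keys Q. {p. int p dvd Poly_Mapping.lookup Q j})"
    using good by blast
  moreover have "finite {p. int p dvd z}" if "z \<noteq> 0" for z
  proof (rule finite_subset)
    show "{p. int p dvd z} \<subseteq> {..nat \<bar>z\<bar>}"
      using that by (auto dest: dvd_imp_le_int simp: le_nat_iff)
  qed simp
  ultimately show ?thesis
    unfolding series_gauss_property_def
    by (elim finite_subset) (intro finite_UN_I finite_keys, simp add: lookup_nonzero)
qed

section \<open>Necessity: the support of the expansion and linear functionals\<close>

lemma representations_zero: "representations 0 = {\<lambda>_. 0}"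
proof (intro equalityI subsetI)
  fix a assume a: "a \<in> representations 0"
  have "a j = 0" if j: "j \<in> J" for j
  proof -
    have "j \<noteq> v" using j v_notin_J by auto
    then obtain i where i: "i \<in> E j" by (auto simp: E_def vec_eq_iff)
    have "(\<Sum>j\<in>{j\<in>J. i \<in> E j}. a j) = 0"
      using incidence_sum[OF a, of i] by (simp only: zero_index mult_zero_right of_nat_eq_0_iff)
    then show ?thesis using i j finite_J by auto
  qed
  then show "a \<in> {\<lambda>_. 0}"
    using a by (auto simp: representations_def)
next
  have "int 0 *s x = 0" for x :: "int ^ 'n" by (simp add: vec_eq_iff)
  then show "a \<in> representations 0" if "a \<in> {\<lambda>_. 0}" for a
    using that by (simp add: representations_def)
qed

lemma inverse_expansion_zero:
  "inverse_expansion Q v 0 = 1 / of_int (Poly_Mapping.lookup Q v)"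
  by (simp add: inverse_expansion_eq representations_zero multinomial_coeff_def monom_coeff_def)

text \<open>The expansion is supported on nonnegative combinations of the vectors
  \<open>j - v\<close>, on each of which \<open>w\<close> is positive.\<close>

lemma inner_pos_if_inverse_expansion_nonzero:
  assumes "inverse_expansion Q v u \<noteq> 0" "u \<noteq> 0"
    and pos: "\<And>j. j \<in> J \<Longrightarrow> w \<bullet> real_exponent v < w \<bullet> real_exponent j"
  shows "0 < w \<bullet> real_exponent u"
proof -
  have "representations u \<noteq> {}"
    using assms(1) by (auto simp: inverse_expansion_eq)
  then obtain a where a: "a \<in> representations u" by auto
  have "a \<noteq> (\<lambda>_. 0)"
    using a assms(2) representations_zero by (auto simp: representations_def)
  then obtain l where l: "l \<in> J" "a l \<noteq> 0"
    using a unfolding representations_def by force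
  have "real_exponent u = (\<Sum>j\<in>J. real (a j) *\<^sub>R (real_exponent j - real_exponent v))"
  proof -
    have u: "u = (\<Sum>j\<in>J. int (a j) *s (j - v))"
      using a by (simp add: representations_def)
    show ?thesis
      by (subst u) (simp add: real_exponent_def vec_eq_iff right_diff_distrib)
  qed
  then have "w \<bullet> real_exponent u = (\<Sum>j\<in>J. real (a j) * (w \<bullet> real_exponent j - w \<bullet> real_exponent v))"
    by (simp add: inner_sum_right inner_diff_right)
  also have "\<dots> > 0"
    using l pos finite_J by (intro sum_pos2[of _ l] mult_nonneg_nonneg) (auto intro: less_imp_le)
  finally show ?thesis .
qed

lemma inner_ge_if_series_gauss_property:
  assumes gauss: "series_gauss_property (laurent_expansion P Q v)"
    and pos: "\<And>j. j \<in> J \<Longrightarrow> w \<bullet> real_exponent v < w \<bullet> real_exponent j"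
    and k: "k \<in> Poly_Mapping.keys P"
  shows "w \<bullet> real_exponent v \<le> w \<bullet> real_exponent k"
proof (rule ccontr)
  assume less: "\<not> ?thesis"
  obtain l where l: "l \<in> Poly_Mapping.keys P"
      and min: "\<And>k. k \<in> Poly_Mapping.keys P \<Longrightarrow> w \<bullet> real_exponent l \<le> w \<bullet> real_exponent k"
    using ex_is_arg_min_if_finite[of "Poly_Mapping.keys P" "\<lambda>k. w \<bullet> real_exponent k"] k
    unfolding is_arg_min_linorder by (metis empty_iff finite_keys)
  let ?F = "laurent_expansion P Q v"
  have neg: "w \<bullet> real_exponent (l - v) < 0"
    using min[OF k] less by (simp add: real_exponent_diff inner_diff_right)
  \<comment> \<open>Since \<open>w\<close> is not positive on \<open>l - k\<close>, only
    \<open>k = l\<close> contributes, through the constant term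
    \<open>inverse_expansion Q v 0\<close>.\<close>
  have F: "?F (l - v) = of_int (Poly_Mapping.lookup P l) / of_int (Poly_Mapping.lookup Q v)"
  proof -
    have "inverse_expansion Q v (l - v - (k - v)) = 0" if "k \<in> Poly_Mapping.keys P" "k \<noteq> l" for k
      using inner_pos_if_inverse_expansion_nonzero[OF _ _ pos, of "l - k"] min[OF that(1)] that(2)
      by (force simp: real_exponent_diff inner_diff_right)
    then have "?F (l - v) = (\<Sum>k\<in>{l}. of_int (Poly_Mapping.lookup P k) * inverse_expansion Q v (l - v - (k - v)))"
      unfolding laurent_expansion_def using l by (intro sum.mono_neutral_right) auto
    then show ?thesis by (simp add: inverse_expansion_zero)
  qed
  have F0: "?F (int p *s (l - v)) = 0" if "prime p" for p
  proof -
    have "inverse_expansion Q v (int p *s (l - v) - (k - v)) = 0" if k: "k \<in> Poly_Mapping.keys P" for k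
    proof (rule ccontr)
      assume nz: "inverse_expansion Q v (int p *s (l - v) - (k - v)) \<noteq> 0"
      \<comment> \<open>As \<open>w\<close> is at least as large on \<open>k - v\<close> as on
        \<open>l - v\<close>, its value at the exponent in question is at most \<open>p - 1\<close>
        times its negative value at \<open>l - v\<close>.\<close>
      have "(real p - 1) * (w \<bullet> real_exponent (l - v)) < 0"
        using neg prime_gt_1_nat[OF \<open>prime p\<close>] by (intro mult_pos_neg) auto
      then have less: "w \<bullet> real_exponent (int p *s (l - v) - (k - v)) < 0"
        using min[OF k]
        unfolding real_exponent_diff real_exponent_scale inner_diff_right inner_scaleR_right
        by (simp add: algebra_simps)
      then have "int p *s (l - v) - (k - v) \<noteq> 0"
        by (metis inner_zero_right less_irrefl real_exponent_zero)
      from inner_pos_if_inverse_expansion_nonzero[OF nz this pos] less show False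
        by linarith
    qed
    then show ?thesis by (simp add: laurent_expansion_def)
  qed
  \<comment> \<open>The congruence with \<open>r = 1\<close> at \<open>l - v\<close> compares 0 with
    the coefficient in \<open>F\<close>. So every prime satisfying the Gauss congruences divides one
    fixed nonzero integer.\<close>
  have "int p dvd Poly_Mapping.lookup P l" if p: "prime p" and "gauss_congruences p ?F" for p
  proof -
    have "cong_prime_power p 1 (?F (int (p ^ 1) *s (l - v))) (?F (int (p ^ (1 - 1)) *s (l - v)))"
      using that(2) unfolding gauss_congruences_def by blast
    moreover have "int (p ^ (1 - 1)) *s (l - v) = l - v"
      by (simp add: vec_eq_iff)
    ultimately have "cong_prime_power p 1 0 (?F (l - v))"
      using F0[OF p] by simp
    then obtain a b where ab: "\<not> int p dvd b" "- ?F (l - v) = of_nat p * (of_int a / of_int b)"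
      unfolding cong_prime_power_def p_integral_def power_one_right diff_0 by blast
    have "b \<noteq> 0" "Poly_Mapping.lookup Q v \<noteq> 0"
      using ab v_key lookup_nonzero by auto
    then have "of_int (Poly_Mapping.lookup P l * b) = (of_int (- int p * a * Poly_Mapping.lookup Q v) :: rat)"
      using ab(2) unfolding F by (simp add: field_simps)
    then have "Poly_Mapping.lookup P l * b = - int p * a * Poly_Mapping.lookup Q v"
      by (simp only: of_int_eq_iff)
    then have "int p dvd Poly_Mapping.lookup P l * b" by simp
    then show ?thesis
      using ab p by (simp add: prime_dvd_mult_iff)
  qed
  then have "{p. prime p} \<subseteq> {p. prime p \<and> \<not> gauss_congruences p ?F} \<union> {p. int p dvd Poly_Mapping.lookup P l}"
    by blast
  moreover have "finite {p. int p dvd Poly_Mapping.lookup P l}"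
  proof (rule finite_subset)
    show "{p. int p dvd Poly_Mapping.lookup P l} \<subseteq> {..nat \<bar>Poly_Mapping.lookup P l\<bar>}"
      using l by (auto dest: dvd_imp_le_int simp: le_nat_iff in_keys_iff)
  qed simp
  ultimately have "finite {p::nat. prime p}"
    using gauss by (auto simp: series_gauss_property_def dest: finite_subset)
  then show False using primes_infinite by blast
qed

end

section \<open>Newton polytopes of polynomials linear in each variable\<close>

lemma real_exponent_in_unit_cube_iff:
  "real_exponent k \<in> cbox 0 1 \<longleftrightarrow> (\<forall>i. k $ i \<in> {0, 1})"
proof -
  have "0 \<le> z \<and> z \<le> 1 \<longleftrightarrow> z \<in> {0, 1}" for z :: int by auto
  then show ?thesis
    by (simp add: mem_box_cart real_exponent_def)
qed

text \<open>On the cube, the functional with signs \<open>1 - 2 * v $ i\<close> exceeds its value at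
  \<open>v\<close> by the sum of the coordinatewise distances to \<open>v\<close>, so its minimum is
  attained only there.\<close>

lemma extreme_point_of_unit_cube:
  fixes v :: "int ^ 'n::finite"
  assumes v: "\<And>i. v $ i \<in> {0, 1}"
  shows "real_exponent v extreme_point_of (cbox 0 1 :: (real ^ 'n) set)"
proof -
  define s :: "real ^ 'n" where "s = (\<chi> i. 1 - 2 * real_of_int (v $ i))"
  have nonneg: "0 \<le> s $ i * (x $ i - real_exponent v $ i)"
    and zero: "s $ i * (x $ i - real_exponent v $ i) = 0 \<Longrightarrow> x $ i = real_exponent v $ i"
    if "x \<in> cbox 0 1" for x i
    using that v[of i] by (auto simp: mem_box_cart s_def real_exponent_def)
  have inner: "s \<bullet> x - s \<bullet> real_exponent v = (\<Sum>i\<in>UNIV. s $ i * (x $ i - real_exponent v $ i))" for x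
    by (simp add: inner_vec_def sum_subtractf algebra_simps)
  have "x = real_exponent v" if x: "x \<in> cbox 0 1" "s \<bullet> x = s \<bullet> real_exponent v" for x
  proof -
    have "s $ i * (x $ i - real_exponent v $ i) = 0" for i
      using inner[of x] x nonneg by (simp add: sum_nonneg_eq_0_iff)
    then show ?thesis
      using zero[OF x(1)] by (simp add: vec_eq_iff)
  qed
  moreover have "real_exponent v \<in> cbox 0 1"
    using v by (simp only: real_exponent_in_unit_cube_iff) blast
  ultimately have "cbox 0 1 \<inter> {x. s \<bullet> x = s \<bullet> real_exponent v} = {real_exponent v}"
    by auto
  moreover have "s \<bullet> real_exponent v \<le> s \<bullet> x" if "x \<in> cbox 0 1" for x
  proof -
    have "0 \<le> s \<bullet> x - s \<bullet> real_exponent v"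
      unfolding inner using nonneg[OF that] by (intro sum_nonneg)
    then show ?thesis by simp
  qed
  ultimately show ?thesis
    by (rule extreme_point_of_Int_supporting_hyperplane_ge)
qed

lemma newton_vertex_in_keys: "newton_vertex Q v \<Longrightarrow> v \<in> Poly_Mapping.keys Q"
  unfolding newton_vertex_def newton_polytope_def
  using extreme_point_of_convex_hull inj_real_exponent by blast

context
  fixes Q :: "('n::finite, int) laurent_poly"
  assumes linear: "linear_in_each_variable Q"
begin

lemma newton_polytope_subset_unit_cube: "newton_polytope Q \<subseteq> cbox 0 1"
  unfolding newton_polytope_def
proof (rule hull_minimal)
  show "real_exponent ` Poly_Mapping.keys Q \<subseteq> cbox 0 1"
    using linear unfolding linear_in_each_variable_def
    by (auto simp only: real_exponent_in_unit_cube_iff)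
qed (rule convex_box)

text \<open>An integer point of the unit cube is one of its vertices, and it stays extreme in any
  subset containing it. Inclusion of Newton polytopes thereby becomes inclusion of supports.\<close>

lemma newton_vertex_if_in_newton_polytope:
  assumes "real_exponent k \<in> newton_polytope Q"
  shows "newton_vertex Q k"
proof -
  have "real_exponent k \<in> cbox 0 1"
    using assms newton_polytope_subset_unit_cube by blast
  then have "real_exponent k extreme_point_of (cbox 0 1 :: (real ^ 'n) set)"
    using extreme_point_of_unit_cube real_exponent_in_unit_cube_iff by blast
  then show ?thesis
    using assms newton_polytope_subset_unit_cube
    by (auto simp: newton_vertex_def extreme_point_of_def)
qed

lemma newton_vertex_if_in_keys:
  "k \<in> Poly_Mapping.keys Q \<Longrightarrow> newton_vertex Q k"
  by (intro newton_vertex_if_in_newton_polytope) (simp add: newton_polytope_def hull_inc)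

lemma in_newton_polytope_if_gauss_property:
  assumes "Q \<noteq> 0" "gauss_property P Q" "k \<in> Poly_Mapping.keys P"
  shows "real_exponent k \<in> newton_polytope Q"
proof (rule ccontr)
  assume notin: "real_exponent k \<notin> newton_polytope Q"
  have "convex (newton_polytope Q)"
    unfolding newton_polytope_def by (rule convex_convex_hull)
  moreover have "closed (newton_polytope Q)"
    unfolding newton_polytope_def by (simp add: compact_imp_closed finite_imp_compact_convex_hull)
  ultimately obtain w b where "w \<bullet> real_exponent k < b"
      and b: "\<And>x. x \<in> newton_polytope Q \<Longrightarrow> b < w \<bullet> x"
    using separating_hyperplane_closed_point[OF _ _ notin] by blast
  then have w: "w \<bullet> real_exponent k < w \<bullet> real_exponent j" if "j \<in> Poly_Mapping.keys Q" for j
  proof -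
    have "real_exponent j \<in> newton_polytope Q"
      using that by (simp add: newton_polytope_def hull_inc)
    then show ?thesis
      using b \<open>w \<bullet> real_exponent k < b\<close> by fastforce
  qed
  \<comment> \<open>The minimizer need not be unique, but every support point is a vertex, so the
    Gauss property is available at \<open>v\<close>.\<close>
  obtain v where v: "v \<in> Poly_Mapping.keys Q"
      and min: "\<And>j. j \<in> Poly_Mapping.keys Q \<Longrightarrow> w \<bullet> real_exponent v \<le> w \<bullet> real_exponent j"
    using ex_is_arg_min_if_finite[of "Poly_Mapping.keys Q" "\<lambda>j. w \<bullet> real_exponent j"] assms(1)
    unfolding is_arg_min_linorder by (metis finite_keys keys_eq_empty)
  interpret linear_polynomial_vertex Q v
    by standard (rule linear, rule v)
  txt \<open>The vector \<open>s\<close> perturbs \<open>w\<close> to a functional whose minimum over the support is attained only at \<open>v\<close>.\<close>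
  define s :: "real ^ 'n" where "s = (\<chi> i. 1 - 2 * real_of_int (v $ i))"
  have s: "0 < s \<bullet> (real_exponent j - real_exponent v)" if j: "j \<in> J" for j
  proof -
    have "s $ i * (real_exponent j - real_exponent v) $ i = of_bool (i \<in> E j)" for i
      using arg_cong[OF diff_component[OF j, of i], of real_of_int]
      by (simp add: s_def real_exponent_def)
    then have "s \<bullet> (real_exponent j - real_exponent v) = card (E j)"
      by (simp add: inner_vec_def)
    moreover have "j \<noteq> v" using j v_notin_J by auto
    then have "E j \<noteq> {}" by (auto simp: E_def vec_eq_iff)
    ultimately show ?thesis by (simp add: card_gt_0_iff)
  qed
  define y where "y = real_exponent k - real_exponent v"
  have y: "w \<bullet> y < 0" using w[OF v] by (simp add: y_def inner_diff_right)
  \<comment> \<open>Chosen so that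
    \<open>d * (1 + \<bar>s \<bullet> y\<bar>) = - (w \<bullet> y)\<close>; the perturbed functional
    is then at most \<open>- d\<close> on \<open>y\<close>.\<close>
  define d where "d = - (w \<bullet> y) / (1 + \<bar>s \<bullet> y\<bar>)"
  have "0 < d" using y by (simp add: d_def divide_neg_pos add_pos_nonneg)
  have "d * (s \<bullet> y) \<le> d * \<bar>s \<bullet> y\<bar>" using \<open>0 < d\<close> by simp
  also have "\<dots> = - (w \<bullet> y) - d"
    by (simp add: d_def field_simps add_pos_nonneg)
  finally have neg: "(w + d *\<^sub>R s) \<bullet> y < 0"
    using \<open>0 < d\<close> by (simp add: inner_add_left)
  have "(w + d *\<^sub>R s) \<bullet> real_exponent v < (w + d *\<^sub>R s) \<bullet> real_exponent j" if j: "j \<in> J" for j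
  proof -
    have "w \<bullet> real_exponent v \<le> w \<bullet> real_exponent j"
      using j insert_v_J by (intro min) auto
    moreover have "0 < d * (s \<bullet> (real_exponent j - real_exponent v))"
      using s[OF j] \<open>0 < d\<close> by simp
    ultimately show ?thesis
      by (simp add: inner_add_left inner_diff_right algebra_simps)
  qed
  moreover have "series_gauss_property (laurent_expansion P Q v)"
    using assms(2) newton_vertex_if_in_keys[OF v] by (simp add: gauss_property_def)
  ultimately have "(w + d *\<^sub>R s) \<bullet> real_exponent v \<le> (w + d *\<^sub>R s) \<bullet> real_exponent k"
    using assms(3) by (intro inner_ge_if_series_gauss_property)
  then show False
    using neg by (simp add: y_def inner_diff_right)
qed

end

theorem theorem5p6:
  fixes P Q :: "('n::finite, int) laurent_poly"
  assumes "is_polynomial P" and "is_polynomial Q"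
    and "Q \<noteq> 0"
    and "linear_in_each_variable Q"
  shows "gauss_property P Q \<longleftrightarrow> newton_polytope P \<subseteq> newton_polytope Q"
proof
  assume "gauss_property P Q"
  then have "real_exponent ` Poly_Mapping.keys P \<subseteq> newton_polytope Q"
    using in_newton_polytope_if_gauss_property[OF assms(4,3)] by blast
  then show "newton_polytope P \<subseteq> newton_polytope Q"
    unfolding newton_polytope_def by (rule hull_minimal) (rule convex_convex_hull)
next
  assume subset: "newton_polytope P \<subseteq> newton_polytope Q"
  have "k \<in> Poly_Mapping.keys Q" if "k \<in> Poly_Mapping.keys P" for k
  proof -
    have "real_exponent k \<in> newton_polytope P"
      using that by (simp add: newton_polytope_def hull_inc)
    with subset show ?thesis
      using newton_vertex_if_in_newton_polytope[OF assms(4)] newton_vertex_in_keys by blast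
  qed
  then have keys: "Poly_Mapping.keys P \<subseteq> Poly_Mapping.keys Q" by blast
  show "gauss_property P Q"
    unfolding gauss_property_def
  proof (intro allI impI)
    fix v assume "newton_vertex Q v"
    then interpret linear_polynomial_vertex Q v
      by (intro linear_polynomial_vertex.intro assms(4) newton_vertex_in_keys)
    show "series_gauss_property (laurent_expansion P Q v)"
      using keys by (rule series_gauss_property_laurent_expansion)
  qed
qed

end
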